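(* Let $X$ be a topological space such that for every countable set $A\subseteq X$ there exists a continuous mapping $\varphi:C_p^*(A)\to C_p(X)$ with $\varphi(y)|_A=y$ for every $y\in C_p^*(A)$. Then: (a) every countable subset $A$ of $X$ that is discrete in the subspace topology is strongly functionally discrete in $X$; (b) if $X$ is a $T_2$-space in which every locally finite system of functionally open sets is finite (in particular, if $X$ is a pseudocompact $T_2$-space), then $X$ is finite; (c) $X$ is not equal to the space of all weak $P$-points of $\beta\omega\setminus\omega$ (with the subspace topology); (d) if $X$ is a completely regular space, then every countable subset $A$ of $X$ is strongly functionally discrete in $X$.
   Context: For a topological space $Z$, $C_p(Z)$ denotes the space of all continuous functions $y:Z\to\mathbb R$ with the topology of pointwise convergence, and $C_p^*(Z)$ denotes its subspace of all bounded continuous functions. Subsets carry the subspace topology. A subset of $Z$ is functionally open if it has the form $g^{-1}(\mathbb R\setminus\{0\})$ for some continuous $g:Z\to\mathbb R$. A family of subsets of $Z$ indexed by a set is discrete if every point of $Z$ has a neighborhood which meets the members of the family for at most one index. A set $A\subseteq X$ is strongly functionally discrete in $X$ if there exists a discrete family $(G_a : a\in A)$ of functionally open subsets of $X$ with $a\in G_a$ for every $a\in A$. A "system" of sets means a set of subsets; it is locally finite if every point has a neighborhood meeting only finitely many of its members. A space is pseudocompact if every continuous real-valued function on it is bounded. $\beta\omega$ is the Stone-Čech compactification of the discrete space $\omega$. A point $x$ of a topological space $Z$ is a weak $P$-point of $Z$ if $x\notin\overline{B}$ for every countable set $B\subseteq Z\setminus\{x\}$. Completely regular spaces are understood to be Hausdorff.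 *)

theory Defs
  imports "HOL-Analysis.Analysis"
begin

text \<open>Since \<^const>\<open>product_topology\<close> has carrier \<^const>\<open>PiE\<close>, the points of the function
  spaces below are extensional, i.e. they correspond bijectively to functions on \<^term>\<open>topspace Z\<close>.\<close>

definition Cp :: "'a topology \<Rightarrow> ('a \<Rightarrow> real) topology" where
  "Cp Z = subtopology (product_topology (\<lambda>_. euclideanreal) (topspace Z))
            {y. continuous_map Z euclideanreal y}"

definition Cp_star :: "'a topology \<Rightarrow> ('a \<Rightarrow> real) topology" where
  "Cp_star Z = subtopology (Cp Z) {y. bounded (y ` topspace Z)}"

definition functionally_open :: "'a topology \<Rightarrow> 'a set \<Rightarrow> bool" where
  "functionally_open Z U \<longleftrightarrow>
     (\<exists>g. continuous_map Z euclideanreal g \<and> U = {x \<in> topspace Z. g x \<noteq> 0})"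

definition discrete_family :: "'a topology \<Rightarrow> 'i set \<Rightarrow> ('i \<Rightarrow> 'a set) \<Rightarrow> bool" where
  "discrete_family Z I G \<longleftrightarrow>
     (\<forall>i\<in>I. G i \<subseteq> topspace Z) \<and>
     (\<forall>x\<in>topspace Z. \<exists>V. openin Z V \<and> x \<in> V \<and>
        (\<forall>i\<in>I. \<forall>j\<in>I. G i \<inter> V \<noteq> {} \<and> G j \<inter> V \<noteq> {} \<longrightarrow> i = j))"

definition strongly_functionally_discrete :: "'a topology \<Rightarrow> 'a set \<Rightarrow> bool" where
  "strongly_functionally_discrete X A \<longleftrightarrow>
     A \<subseteq> topspace X \<and>
     (\<exists>G. discrete_family X A G \<and> (\<forall>a\<in>A. functionally_open X (G a) \<and> a \<in> G a))"

definition pseudocompact_space :: "'a topology \<Rightarrow> bool" where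
  "pseudocompact_space Z \<longleftrightarrow>
     (\<forall>g. continuous_map Z euclideanreal g \<longrightarrow> bounded (g ` topspace Z))"

definition weak_P_point :: "'a topology \<Rightarrow> 'a \<Rightarrow> bool" where
  "weak_P_point Z x \<longleftrightarrow>
     x \<in> topspace Z \<and>
     (\<forall>B. countable B \<and> B \<subseteq> topspace Z - {x} \<longrightarrow> x \<notin> Z closure_of B)"

text \<open>The Stone-Cech compactification of a space is the closure of its image in the
  Tychonoff cube indexed by its continuous maps to the unit interval, under the evaluation map.\<close>

definition unit_maps :: "'a topology \<Rightarrow> ('a \<Rightarrow> real) set" where
  "unit_maps Z =
     {f \<in> extensional (topspace Z). continuous_map Z (top_of_set {0..1}) f}"

definition stone_cech_embed :: "'a topology \<Rightarrow> 'a \<Rightarrow> ('a \<Rightarrow> real) \<Rightarrow> real" where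
  "stone_cech_embed Z x = (\<lambda>f\<in>unit_maps Z. f x)"

definition stone_cech :: "'a topology \<Rightarrow> (('a \<Rightarrow> real) \<Rightarrow> real) topology" where
  "stone_cech Z =
     (let T = product_topology (\<lambda>_. top_of_set {0..1}) (unit_maps Z)
      in subtopology T (T closure_of (stone_cech_embed Z ` topspace Z)))"

definition stone_cech_remainder :: "'a topology \<Rightarrow> (('a \<Rightarrow> real) \<Rightarrow> real) topology" where
  "stone_cech_remainder Z =
     subtopology (stone_cech Z) (topspace (stone_cech Z) - stone_cech_embed Z ` topspace Z)"

abbreviation omega_star :: "((nat \<Rightarrow> real) \<Rightarrow> real) topology" where
  "omega_star \<equiv> stone_cech_remainder (discrete_topology UNIV)"

definition weak_P_points_omega_star :: "((nat \<Rightarrow> real) \<Rightarrow> real) topology" where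
  "weak_P_points_omega_star = subtopology omega_star {p. weak_P_point omega_star p}"

end

theory Submission
  imports Defs
begin

text \<open>The hypothesis is used through one consequence: a pointwise null sequence of bounded continuous
  functions on a countable set \<open>A\<close> extends to a pointwise null sequence of continuous functions on \<open>X\<close>
  (\<open>extender_null_sequence\<close>).

  If \<open>A\<close> is discrete, apply this to the indicator functions of the final segments of an enumeration
  of \<open>A\<close>. Since the extensions tend to \<open>0\<close> at every point of \<open>X\<close>, a locally finite series of products
  formed from them is a continuous function on \<open>X\<close> with distinct positive integers as values on \<open>A\<close>
  (\<open>extender_separating_function\<close>). The preimages of small intervals around these values form the desired
  discrete family. As every infinite Hausdorff space has a countably infinite discrete subspace, the same
  function and the same family show that a Hausdorff space in which locally finite systems
  of functionally open sets are finite, or which is pseudocompact, must be finite. In a completely regular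
  Hausdorff space, a point \<open>a\<close> of \<open>A\<close> in the closure of \<open>A - {a}\<close> would contradict the extension of
  null sequences, so countable sets are discrete.

  The claim on weak P-points requires that they exist, which is a theorem of Kunen. The proof here
  builds an ultrafilter on the natural numbers by a recursion of length continuum, along which the
  rows of an independent linked matrix are spent (\<open>exists_independent_linked_matrix\<close>,
  \<open>exists_deciding_family\<close>). The recursion may start with any filter of the form
  \<open>columnwise_cofinite A\<close>, so every sequence of disjoint infinite subsets of the natural numbers accumulates
  at a weak P-point (\<open>exists_weak_P_point\<close>). Hence the weak P-points are dense in the remainder, and no
  infinite sequence of nonempty open sets of weak P-points is a discrete family. But in the space of weak
  P-points all countable sets are discrete, so the first claim would supply such a family.\<close>

section \<open>Continuous extension of null sequences\<close>

text \<open>The extension property of a single subset \<open>A\<close>: some continuous, not necessarily linear, map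
  assigns to every bounded continuous function on \<open>A\<close> an extension to \<open>X\<close>.\<close>
definition has_extender :: "'a topology \<Rightarrow> 'a set \<Rightarrow> bool" where
  "has_extender X A \<longleftrightarrow>
     (\<exists>\<phi>. continuous_map (Cp_star (subtopology X A)) (Cp X) \<phi> \<and>
          (\<forall>y\<in>topspace (Cp_star (subtopology X A)). restrict (\<phi> y) A = y))"

lemma topspace_Cp:
  "topspace (Cp Z) = {y \<in> extensional (topspace Z). continuous_map Z euclideanreal y}"
  by (auto simp: Cp_def PiE_def)

lemma topspace_Cp_star:
  "topspace (Cp_star Z) =
     {y \<in> extensional (topspace Z). continuous_map Z euclideanreal y \<and> bounded (y ` topspace Z)}"
  by (auto simp: Cp_star_def topspace_Cp)

lemma limitin_Cp:
  "limitin (Cp Z) y l F \<longleftrightarrow>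
     l \<in> topspace (Cp Z) \<and> (\<forall>\<^sub>F k in F. y k \<in> topspace (Cp Z)) \<and>
     (\<forall>z\<in>topspace Z. ((\<lambda>k. y k z) \<longlongrightarrow> l z) F)"
  unfolding Cp_def limitin_subtopology limitin_componentwise
  by (auto simp: topspace_Cp PiE_def elim: eventually_mono intro: eventually_conj)

lemma limitin_Cp_star:
  "limitin (Cp_star Z) y l F \<longleftrightarrow>
     l \<in> topspace (Cp_star Z) \<and> (\<forall>\<^sub>F k in F. y k \<in> topspace (Cp_star Z)) \<and>
     (\<forall>z\<in>topspace Z. ((\<lambda>k. y k z) \<longlongrightarrow> l z) F)"
  unfolding Cp_star_def limitin_subtopology limitin_Cp
  by (auto elim: eventually_mono intro: eventually_conj)

text \<open>The only way in which continuity of the extender is used: a pointwise null sequence of bounded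
  continuous functions on \<open>A\<close> extends to a pointwise null sequence on all of \<open>X\<close>.\<close>
lemma extender_null_sequence:
  fixes y :: "nat \<Rightarrow> 'a \<Rightarrow> real"
  assumes X: "has_extender X A" and AX: "A \<subseteq> topspace X"
    and cont: "\<And>k. continuous_map (subtopology X A) euclideanreal (y k)"
    and bdd: "\<And>k. bounded (y k ` A)"
    and lim: "\<And>a. a \<in> A \<Longrightarrow> (\<lambda>k. y k a) \<longlonglongrightarrow> 0"
  obtains f where "\<And>k. continuous_map X euclideanreal (f k)"
    and "\<And>k a. a \<in> A \<Longrightarrow> f k a = y k a"
    and "\<And>x. x \<in> topspace X \<Longrightarrow> (\<lambda>k. f k x) \<longlonglongrightarrow> 0"
proof -
  obtain \<phi> where \<phi>: "continuous_map (Cp_star (subtopology X A)) (Cp X) \<phi>"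
    and ext: "\<And>y. y \<in> topspace (Cp_star (subtopology X A)) \<Longrightarrow> restrict (\<phi> y) A = y"
    using X by (auto simp: has_extender_def)
  have A: "topspace (subtopology X A) = A"
    using AX by auto
  define z where "z k = restrict (y k) A" for k
  define o' where "o' = restrict (\<lambda>_. 0::real) A"
  have z: "z k \<in> topspace (Cp_star (subtopology X A))" for k
  proof -
    have "continuous_map (subtopology X A) euclideanreal (z k)"
      by (rule continuous_map_eq[OF cont[of k]]) (auto simp: z_def)
    moreover have "z k ` A = y k ` A"
      by (auto simp: z_def)
    ultimately show ?thesis
      using bdd[of k] by (simp add: topspace_Cp_star A z_def del: topspace_subtopology)
  qed
  have "continuous_map (subtopology X A) euclideanreal o'"
    by (rule continuous_map_eq[of _ _ "\<lambda>_. 0"]) (auto simp: o'_def)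
  moreover have "o' ` A \<subseteq> {0}"
    by (auto simp: o'_def)
  ultimately have o': "o' \<in> topspace (Cp_star (subtopology X A))"
    using bounded_subset[of "{0::real}"]
    by (simp add: topspace_Cp_star A o'_def del: topspace_subtopology)
  have "limitin (Cp_star (subtopology X A)) z o' sequentially"
    unfolding limitin_Cp_star using z o' lim by (auto simp: z_def o'_def A)
  then have lim': "limitin (Cp X) (\<phi> \<circ> z) (\<phi> o') sequentially"
    by (rule continuous_map_limit[OF \<phi>])
  have cm: "continuous_map X euclideanreal (\<phi> u)" if "u \<in> topspace (Cp_star (subtopology X A))" for u
    using continuous_map_image_subset_topspace[OF \<phi>] that by (auto simp: topspace_Cp)
  have val: "\<phi> u a = u a" if "u \<in> topspace (Cp_star (subtopology X A))" "a \<in> A" for u a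
    using ext[OF that(1)] that(2) by (metis restrict_apply')
  show ?thesis
  proof
    \<comment> \<open>The extender need not map \<open>0\<close> to \<open>0\<close>, so its value at \<open>0\<close> is subtracted.\<close>
    show "continuous_map X euclideanreal (\<lambda>x. \<phi> (z k) x - \<phi> o' x)" for k
      by (intro continuous_map_diff cm z o')
    show "\<phi> (z k) a - \<phi> o' a = y k a" if "a \<in> A" for k a
      using val[OF z that] val[OF o' that] that by (simp add: z_def o'_def)
    show "(\<lambda>k. \<phi> (z k) x - \<phi> o' x) \<longlonglongrightarrow> 0" if "x \<in> topspace X" for x
      using lim' that LIM_zero unfolding limitin_Cp o_def by blast
  qed
qed

text \<open>The cut-off \<open>c\<close> vanishes on arguments \<open>\<le> 1/2\<close> and fixes \<open>0\<close> and \<open>1\<close>. Wherever \<open>f n x < 1/2\<close>,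
  every product containing the factor for \<open>n\<close> vanishes; these open sets cover the space, so the
  series is locally a finite sum.\<close>
lemma continuous_map_suminf_of_prods:
  fixes f :: "nat \<Rightarrow> 'a \<Rightarrow> real"
  assumes cont: "\<And>k. continuous_map X euclideanreal (f k)"
    and lim: "\<And>x. x \<in> topspace X \<Longrightarrow> (\<lambda>k. f k x) \<longlonglongrightarrow> 0"
  defines "c \<equiv> \<lambda>t. max 0 (2 * t - 1)"
  shows "continuous_map X euclideanreal (\<lambda>x. \<Sum>k. \<Prod>j\<le>k. c (f j x))"
proof (rule pasting_lemma[where I = UNIV and T = "\<lambda>n. {x \<in> topspace X. f n x < 1/2}"
                            and f = "\<lambda>n x. \<Sum>k<n. \<Prod>j\<le>k. c (f j x)"])
  have sum_eq: "(\<Sum>k. \<Prod>j\<le>k. c (f j x)) = (\<Sum>k<n. \<Prod>j\<le>k. c (f j x))" if "f n x < 1/2" for n x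
  proof (rule suminf_finite)
    fix k assume "k \<notin> {..<n}"
    then show "(\<Prod>j\<le>k. c (f j x)) = 0"
      using that by (auto simp: c_def intro!: prod_zero bexI[of _ n])
  qed auto
  show "openin X {x \<in> topspace X. f n x < 1/2}" for n
    using openin_continuous_map_preimage[OF cont[of n], of "{..<1/2}"] by simp
  show "continuous_map (subtopology X {x \<in> topspace X. f n x < 1/2}) euclideanreal
          (\<lambda>x. \<Sum>k<n. \<Prod>j\<le>k. c (f j x))" for n
    unfolding c_def
    by (intro continuous_map_from_subtopology continuous_intros cont) (auto intro!: continuous_intros cont)
  show "(\<Sum>k<m. \<Prod>j\<le>k. c (f j x)) = (\<Sum>k<n. \<Prod>j\<le>k. c (f j x))"
    if "x \<in> topspace X \<inter> {x \<in> topspace X. f m x < 1/2} \<inter> {x \<in> topspace X. f n x < 1/2}" for m n x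
    using sum_eq[of m x] sum_eq[of n x] that by auto
  show "\<exists>n. n \<in> UNIV \<and> x \<in> {x \<in> topspace X. f n x < 1/2} \<and>
          (\<Sum>k. \<Prod>j\<le>k. c (f j x)) = (\<Sum>k<n. \<Prod>j\<le>k. c (f j x))" if "x \<in> topspace X" for x
  proof -
    have "\<forall>\<^sub>F n in sequentially. f n x < 1/2"
      by (rule order_tendstoD(2)[OF lim[OF that]]) simp
    then obtain n where "f n x < 1/2"
      by (meson eventually_happens' sequentially_bot)
    then show ?thesis using sum_eq that by auto
  qed
qed

text \<open>The functions that are \<open>1\<close> at the points of index at least \<open>k\<close> and \<open>0\<close> elsewhere form
  a null sequence on \<open>A\<close>. At the point of index \<open>n\<close> exactly the first \<open>n + 1\<close> of their
  extensions are \<open>1\<close> and the others are \<open>0\<close>, and the series above counts them. The resulting function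
  is unbounded when \<open>A\<close> is infinite.\<close>
lemma extender_separating_function:
  assumes X: "has_extender X A" and AX: "A \<subseteq> topspace X" and cA: "countable A"
    and disc: "subtopology X A = discrete_topology A"
  obtains g where "continuous_map X euclideanreal g"
    and "\<And>a. a \<in> A \<Longrightarrow> g a = real (Suc (to_nat_on A a))"
proof -
  define y where "y k a = (if k \<le> to_nat_on A a then 1 else 0 :: real)" for k a
  obtain f where f: "\<And>k. continuous_map X euclideanreal (f k)"
    and fy: "\<And>k a. a \<in> A \<Longrightarrow> f k a = y k a"
    and f0: "\<And>x. x \<in> topspace X \<Longrightarrow> (\<lambda>k. f k x) \<longlonglongrightarrow> 0"
  proof (rule extender_null_sequence[OF X AX, of y])
    show "continuous_map (subtopology X A) euclideanreal (y k)" for k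
      by (simp add: disc)
    have "y k ` A \<subseteq> {0..1}" for k by (auto simp: y_def)
    then show "bounded (y k ` A)" for k
      using bounded_closed_interval bounded_subset by blast
    show "(\<lambda>k. y k a) \<longlonglongrightarrow> 0" for a
      by (rule tendsto_eventually, rule eventually_sequentiallyI[of "Suc (to_nat_on A a)"])
         (auto simp: y_def)
  qed auto
  define c :: "real \<Rightarrow> real" where "c t = max 0 (2 * t - 1)" for t
  show ?thesis
  proof
    show "continuous_map X euclideanreal (\<lambda>x. \<Sum>k. \<Prod>j\<le>k. c (f j x))"
      unfolding c_def by (rule continuous_map_suminf_of_prods[OF f f0])
    fix a assume a: "a \<in> A"
    have c: "c (f j a) = (if j \<le> to_nat_on A a then 1 else 0)" for j
      using fy[OF a] by (simp add: y_def c_def)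
    have "(\<Sum>k. \<Prod>j\<le>k. c (f j a)) = (\<Sum>k\<le>to_nat_on A a. \<Prod>j\<le>k. c (f j a))"
      by (rule suminf_finite) (auto simp: c)
    also have "\<dots> = (\<Sum>k\<le>to_nat_on A a. 1)"
      by (intro sum.cong prod.neutral) (auto simp: c)
    finally show "(\<Sum>k. \<Prod>j\<le>k. c (f j a)) = real (Suc (to_nat_on A a))"
      by simp
  qed
qed

lemma strongly_functionally_discrete_if_discrete:
  assumes X: "has_extender X A" and AX: "A \<subseteq> topspace X" and cA: "countable A"
    and disc: "subtopology X A = discrete_topology A"
  shows "strongly_functionally_discrete X A"
proof -
  obtain g where g: "continuous_map X euclideanreal g"
    and ga: "\<And>a. a \<in> A \<Longrightarrow> g a = real (Suc (to_nat_on A a))"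
    using extender_separating_function[OF assms] by metis
  define G where "G a = {x \<in> topspace X. \<bar>g x - g a\<bar> < 1/4}" for a
  have "discrete_family X A G"
    unfolding discrete_family_def
  proof (intro conjI ballI)
    show "G a \<subseteq> topspace X" for a
      by (auto simp: G_def)
    fix x assume x: "x \<in> topspace X"
    show "\<exists>V. openin X V \<and> x \<in> V \<and>
            (\<forall>a\<in>A. \<forall>b\<in>A. G a \<inter> V \<noteq> {} \<and> G b \<inter> V \<noteq> {} \<longrightarrow> a = b)"
    proof (intro exI conjI ballI impI)
      show "openin X {z \<in> topspace X. g z \<in> ball (g x) (1/4)}"
        by (rule openin_continuous_map_preimage[OF g]) auto
      show "x \<in> {z \<in> topspace X. g z \<in> ball (g x) (1/4)}"
        using x by auto
      fix a b
      assume ab: "a \<in> A" "b \<in> A"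
        and "G a \<inter> {z \<in> topspace X. g z \<in> ball (g x) (1/4)} \<noteq> {} \<and>
             G b \<inter> {z \<in> topspace X. g z \<in> ball (g x) (1/4)} \<noteq> {}"
      then obtain u v where "\<bar>g u - g a\<bar> < 1/4" "\<bar>g x - g u\<bar> < 1/4"
        "\<bar>g v - g b\<bar> < 1/4" "\<bar>g x - g v\<bar> < 1/4"
        by (auto simp: G_def dist_real_def)
      then have "\<bar>g a - g b\<bar> < 1"
        by linarith
      then have "to_nat_on A a = to_nat_on A b"
        using ga ab by auto
      then show "a = b"
        using ab cA by simp
    qed
  qed
  moreover have "functionally_open X (G a)" for a
  proof -
    have cont: "continuous_map X euclideanreal (\<lambda>x. max 0 (1/4 - \<bar>g x - g a\<bar>))"
      by (intro continuous_intros g)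
    have "G a = {x \<in> topspace X. max 0 (1/4 - \<bar>g x - g a\<bar>) \<noteq> 0}"
      by (auto simp: G_def max_def)
    with cont show ?thesis
      unfolding functionally_open_def by blast
  qed
  moreover have "a \<in> G a" if "a \<in> A" for a
    using that AX by (auto simp: G_def)
  ultimately show ?thesis
    using AX by (auto simp: strongly_functionally_discrete_def)
qed

section \<open>Finiteness of Hausdorff spaces with extenders\<close>

lemma subtopology_eq_discrete_iff:
  assumes "A \<subseteq> topspace X"
  shows "subtopology X A = discrete_topology A \<longleftrightarrow>
           (\<forall>a\<in>A. \<exists>U. openin X U \<and> U \<inter> A = {a})"
proof -
  have "openin (subtopology X A) {a} \<longleftrightarrow> (\<exists>U. openin X U \<and> U \<inter> A = {a})" for a
    unfolding openin_subtopology by metis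
  moreover have "topspace (subtopology X A) = A"
    using assms by auto
  ultimately show ?thesis
    by (metis discrete_topology_unique)
qed

text \<open>One step in the construction of an infinite discrete subspace: split off a point with an open
  neighbourhood while leaving an infinite open set disjoint from it. Of two disjoint open sets in \<open>Y\<close>
  one may be finite; then its points are isolated, and a single point can be split off.\<close>
lemma Hausdorff_infinite_open_split:
  assumes X: "Hausdorff_space X" and Y: "openin X Y" "infinite Y"
  shows "\<exists>U y W. openin X U \<and> openin X W \<and> y \<in> U \<and> U \<subseteq> Y \<and> W \<subseteq> Y \<and> U \<inter> W = {} \<and> infinite W"
proof -
  obtain x where x: "x \<in> Y"
    using Y(2) by (metis ex_in_conv finite.emptyI)
  have "infinite (Y - {x})"
    using Y(2) by simp
  then obtain z where z: "z \<in> Y" "z \<noteq> x"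
    by (metis Diff_iff ex_in_conv finite.emptyI insertI1)
  have "x \<in> topspace X" "z \<in> topspace X"
    using x z Y(1) openin_subset by blast+
  then obtain U V where UV: "openin X U" "openin X V" "x \<in> U" "z \<in> V" "U \<inter> V = {}"
    using X z(2) unfolding Hausdorff_space_def disjnt_def by metis
  have t1: "openin X (S - F)" if "openin X S" "finite F" for S F
  proof -
    have "closedin X (topspace X \<inter> F)"
      using Hausdorff_imp_t1_space[OF X] that(2) t1_space_closedin_finite by blast
    then have "openin X (S - topspace X \<inter> F)"
      using openin_diff[OF that(1)] by blast
    moreover have "S - topspace X \<inter> F = S - F"
      using openin_subset[OF that(1)] by auto
    ultimately show ?thesis by simp
  qed
  show ?thesis
  proof (cases "finite (V \<inter> Y)")
    case True
    have "V \<inter> Y - (V \<inter> Y - {z}) = {z}"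
      using UV z by auto
    then have "openin X {z}"
      using t1[of "V \<inter> Y" "V \<inter> Y - {z}"] True UV Y(1) by auto
    moreover have "openin X (Y - {z})"
      using t1 Y(1) by simp
    ultimately show ?thesis
      using z Y by (intro exI[of _ "{z}"] exI[of _ z] exI[of _ "Y - {z}"]) auto
  next
    case False
    then show ?thesis
      using UV x Y(1) by (intro exI[of _ "U \<inter> Y"] exI[of _ x] exI[of _ "V \<inter> Y"]) auto
  qed
qed

lemma Hausdorff_infinite_discrete_subspace:
  assumes X: "Hausdorff_space X" and inf: "infinite (topspace X)"
  obtains A where "A \<subseteq> topspace X" "countable A" "infinite A"
    "subtopology X A = discrete_topology A"
proof -
  define P :: "('a set \<times> 'a \<times> 'a set) \<Rightarrow> bool" where
    "P = (\<lambda>(U, y, W). openin X U \<and> openin X W \<and> y \<in> U \<and> U \<inter> W = {} \<and> infinite W)"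
  define Q :: "('a set \<times> 'a \<times> 'a set) \<Rightarrow> ('a set \<times> 'a \<times> 'a set) \<Rightarrow> bool" where
    "Q = (\<lambda>(_, _, W) (U', _, W'). U' \<subseteq> W \<and> W' \<subseteq> W)"
  have "\<exists>s. \<forall>n. P (s n) \<and> Q (s n) (s (Suc n))"
  proof (rule dependent_nat_choice)
    show "\<exists>t. P t"
      using Hausdorff_infinite_open_split[OF X openin_topspace inf] by (auto simp: P_def)
    fix t :: "'a set \<times> 'a \<times> 'a set"
    assume "P t"
    then obtain W where W: "openin X W" "infinite W" "snd (snd t) = W"
      by (cases t) (auto simp: P_def)
    show "\<exists>t'. P t' \<and> Q t t'"
    proof -
      obtain U y W' where "openin X U" "openin X W'" "y \<in> U" "U \<subseteq> W" "W' \<subseteq> W"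
        "U \<inter> W' = {}" "infinite W'"
        using Hausdorff_infinite_open_split[OF X W(1,2)] by blast
      then show ?thesis
        using W(3) by (intro exI[of _ "(U, y, W')"]) (auto simp: P_def Q_def split: prod.splits)
    qed
  qed
  then obtain s where s: "\<And>n. P (s n)" "\<And>n. Q (s n) (s (Suc n))"
    by blast
  define U where "U n = fst (s n)" for n
  define y where "y n = fst (snd (s n))" for n
  define W where "W n = snd (snd (s n))" for n
  have U: "openin X (U n)" "y n \<in> U n" "U n \<inter> W n = {}" for n
    using s(1)[of n] by (auto simp: P_def U_def y_def W_def split: prod.splits)
  have step: "U (Suc n) \<subseteq> W n" "W (Suc n) \<subseteq> W n" for n
    using s(2)[of n] by (auto simp: Q_def U_def W_def split: prod.splits)
  have W_anti: "W n \<subseteq> W m" if "m \<le> n" for m n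
    using step(2) that by (rule lift_Suc_antimono_le)
  have "U m \<inter> U n = {}" if "m < n" for m n
  proof -
    obtain k where "n = Suc k" "m \<le> k"
      using \<open>m < n\<close> by (metis less_Suc_eq_le less_imp_Suc_add)
    then show ?thesis
      using U(3)[of m] step(1)[of k] W_anti[of m k] by blast
  qed
  then have disj: "U m \<inter> U n = {}" if "m \<noteq> n" for m n
    using that by (metis Int_commute linorder_neqE_nat)
  have "inj y"
    using disj U(2) by (metis disjoint_iff injI)
  show ?thesis
  proof
    show sub: "range y \<subseteq> topspace X"
      using U openin_subset by blast
    show "countable (range y)" by simp
    show "infinite (range y)"
      using \<open>inj y\<close> finite_imageD by blast
    show "subtopology X (range y) = discrete_topology (range y)"
      unfolding subtopology_eq_discrete_iff[OF sub]
    proof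
      fix a assume "a \<in> range y"
      then obtain n where a: "a = y n" by blast
      have "U n \<inter> range y = {a}"
        using U(2) disj unfolding a by (auto, metis disjoint_iff)
      then show "\<exists>U. openin X U \<and> U \<inter> range y = {a}"
        using U(1) by blast
    qed
  qed
qed

lemma discrete_family_nhd:
  assumes "discrete_family X I G" "x \<in> topspace X"
  obtains V where "openin X V" "x \<in> V"
    "\<And>i j. i \<in> I \<Longrightarrow> j \<in> I \<Longrightarrow> G i \<inter> V \<noteq> {} \<Longrightarrow> G j \<inter> V \<noteq> {} \<Longrightarrow> i = j"
proof -
  have "\<exists>V. openin X V \<and> x \<in> V \<and>
          (\<forall>i\<in>I. \<forall>j\<in>I. G i \<inter> V \<noteq> {} \<and> G j \<inter> V \<noteq> {} \<longrightarrow> i = j)"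
    using assms unfolding discrete_family_def by simp
  then show ?thesis
    using that by (metis (no_types, lifting))
qed

lemma discrete_family_disjoint:
  assumes "discrete_family X I G" "i \<in> I" "j \<in> I" "i \<noteq> j"
  shows "G i \<inter> G j = {}"
proof (rule ccontr)
  assume "G i \<inter> G j \<noteq> {}"
  then obtain x where x: "x \<in> G i" "x \<in> G j"
    by blast
  then have "x \<in> topspace X"
    using assms(1,2) by (auto simp: discrete_family_def)
  then obtain V where "x \<in> V" and
    V: "\<And>i j. i \<in> I \<Longrightarrow> j \<in> I \<Longrightarrow> G i \<inter> V \<noteq> {} \<Longrightarrow> G j \<inter> V \<noteq> {} \<Longrightarrow> i = j"
    using discrete_family_nhd[OF assms(1)] by metis
  have "i = j"
    by (rule V) (use x \<open>x \<in> V\<close> assms in auto)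
  with assms(4) show False
    by simp
qed

lemma discrete_family_locally_finite_in:
  assumes "discrete_family X I G"
  shows "locally_finite_in X (G ` I)"
  unfolding locally_finite_in_def
proof (intro conjI ballI)
  show "\<Union> (G ` I) \<subseteq> topspace X"
    using assms by (auto simp: discrete_family_def)
  fix x assume "x \<in> topspace X"
  then obtain V where V: "openin X V" "x \<in> V"
    "\<And>i j. i \<in> I \<Longrightarrow> j \<in> I \<Longrightarrow> G i \<inter> V \<noteq> {} \<Longrightarrow> G j \<inter> V \<noteq> {} \<Longrightarrow> i = j"
    using discrete_family_nhd[OF assms] by metis
  have "\<exists>i. {U \<in> G ` I. U \<inter> V \<noteq> {}} \<subseteq> {G i}"
  proof (cases "\<exists>i\<in>I. G i \<inter> V \<noteq> {}")
    case True
    then obtain i where i: "i \<in> I" "G i \<inter> V \<noteq> {}"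
      by blast
    then have "{U \<in> G ` I. U \<inter> V \<noteq> {}} \<subseteq> {G i}"
      using V(3)[OF _ i(1) _ i(2)] by fast
    then show ?thesis ..
  qed fast
  then have "finite {U \<in> G ` I. U \<inter> V \<noteq> {}}"
    by (meson finite.emptyI finite_insert finite_subset)
  then show "\<exists>V. openin X V \<and> x \<in> V \<and> finite {U \<in> G ` I. U \<inter> V \<noteq> {}}"
    using V by blast
qed

lemma finite_if_locally_finite_functionally_open:
  assumes X: "\<And>A. A \<subseteq> topspace X \<Longrightarrow> countable A \<Longrightarrow> has_extender X A"
    and H: "Hausdorff_space X"
    and lf: "\<And>\<U>. \<forall>U\<in>\<U>. functionally_open X U \<Longrightarrow> locally_finite_in X \<U> \<Longrightarrow> finite \<U>"
  shows "finite (topspace X)"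
proof (rule ccontr)
  assume "infinite (topspace X)"
  then obtain A where A: "A \<subseteq> topspace X" "countable A" "infinite A"
    "subtopology X A = discrete_topology A"
    using Hausdorff_infinite_discrete_subspace[OF H] by metis
  then have "strongly_functionally_discrete X A"
    by (intro strongly_functionally_discrete_if_discrete X)
  then obtain G where G: "discrete_family X A G" "\<And>a. a \<in> A \<Longrightarrow> functionally_open X (G a)"
    "\<And>a. a \<in> A \<Longrightarrow> a \<in> G a"
    by (auto simp: strongly_functionally_discrete_def)
  have "finite (G ` A)"
    using G discrete_family_locally_finite_in by (intro lf) auto
  moreover have "inj_on G A"
    using discrete_family_disjoint[OF G(1)] G(3) by (metis disjoint_iff inj_onI)
  ultimately show False
    using A(3) finite_imageD by blast
qed

lemma finite_if_pseudocompact: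
  assumes X: "\<And>A. A \<subseteq> topspace X \<Longrightarrow> countable A \<Longrightarrow> has_extender X A"
    and H: "Hausdorff_space X" and ps: "pseudocompact_space X"
  shows "finite (topspace X)"
proof (rule ccontr)
  assume "infinite (topspace X)"
  then obtain A where A: "A \<subseteq> topspace X" "countable A" "infinite A"
    "subtopology X A = discrete_topology A"
    using Hausdorff_infinite_discrete_subspace[OF H] by metis
  then obtain g where g: "continuous_map X euclideanreal g"
    and ga: "\<And>a. a \<in> A \<Longrightarrow> g a = real (Suc (to_nat_on A a))"
    using extender_separating_function[of X A] X by metis
  obtain M where M: "\<And>x. x \<in> topspace X \<Longrightarrow> \<bar>g x\<bar> \<le> M"
    using ps g unfolding pseudocompact_space_def bounded_iff by fastforce
  have "to_nat_on A ` A \<subseteq> {..nat \<lceil>M\<rceil>}"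
  proof
    fix n assume "n \<in> to_nat_on A ` A"
    then obtain a where "a \<in> A" "n = to_nat_on A a" by blast
    then show "n \<in> {..nat \<lceil>M\<rceil>}"
      using M[of a] ga[of a] A(1) le_nat_iff by (auto simp: subset_iff) linarith
  qed
  then have "finite (to_nat_on A ` A)"
    using finite_subset by blast
  then show False
    using A(2,3) finite_imageD inj_on_to_nat_on by blast
qed

section \<open>Countable subsets of completely regular spaces with extenders\<close>

text \<open>If \<open>a\<close> were in the closure of \<open>B = A - {a}\<close>, then the finite products of functions that
  are \<open>1\<close> at \<open>a\<close> and vanish at one point of \<open>B\<close> would form a null sequence on \<open>B\<close>, whose
  extensions to \<open>X\<close> are forced by continuity to take the value \<open>1\<close> at \<open>a\<close>.\<close>
lemma extender_completely_regular_imp_discrete: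
  assumes X: "\<And>B. B \<subseteq> A \<Longrightarrow> has_extender X B" and AX: "A \<subseteq> topspace X" and cA: "countable A"
    and cr: "completely_regular_space X" and H: "Hausdorff_space X"
  shows "subtopology X A = discrete_topology A"
  unfolding subtopology_eq_discrete_iff[OF AX]
proof
  fix a assume a: "a \<in> A"
  define B where "B = A - {a}"
  have BX: "B \<subseteq> topspace X" and cB: "countable B" and aX: "a \<in> topspace X"
    using AX cA a by (auto simp: B_def)
  have "a \<notin> X closure_of B"
  proof
    assume cl: "a \<in> X closure_of B"
    have "\<exists>h. continuous_map X (top_of_set {0..1}) h \<and> h b = 0 \<and> h a = (1::real)" if "b \<in> B" for b
    proof -
      have "closedin X {a}" "b \<in> topspace X - {a}"
        using Hausdorff_imp_t1_space[OF H] aX BX that by (auto simp: t1_space_closedin_singleton B_def)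
      then show ?thesis
        using cr unfolding completely_regular_space_def by blast
    qed
    then obtain h where h: "\<And>b. b \<in> B \<Longrightarrow> continuous_map X (top_of_set {0..1}) (h b)"
      "\<And>b. b \<in> B \<Longrightarrow> h b b = (0::real)" "\<And>b. b \<in> B \<Longrightarrow> h b a = 1"
      by metis
    define F where "F k = {b \<in> B. to_nat_on B b < k}" for k
    have finF: "finite (F k)" for k
      by (rule inj_on_finite[of "to_nat_on B" _ "{..<k}"])
         (auto simp: F_def cB intro: inj_on_subset[OF inj_on_to_nat_on])
    define y where "y k x = (\<Prod>b\<in>F k. h b x)" for k x
    have y: "continuous_map X euclideanreal (y k)" for k
      unfolding y_def using h(1) finF
      by (intro continuous_map_prod) (auto simp: F_def continuous_map_in_subtopology)
    have h01: "0 \<le> h b x \<and> h b x \<le> 1" if "b \<in> B" "x \<in> topspace X" for b x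
      using continuous_map_image_subset_topspace[OF h(1)] that by fastforce
    obtain f where f: "\<And>k. continuous_map X euclideanreal (f k)"
      and fy: "\<And>k b. b \<in> B \<Longrightarrow> f k b = y k b"
      and f0: "\<And>x. x \<in> topspace X \<Longrightarrow> (\<lambda>k. f k x) \<longlonglongrightarrow> 0"
    proof (rule extender_null_sequence[OF _ BX, of y])
      show "has_extender X B"
        by (rule X) (auto simp: B_def)
      show "continuous_map (subtopology X B) euclideanreal (y k)" for k
        using y continuous_map_from_subtopology by blast
      have "y k ` B \<subseteq> {0..1}" for k
        using h01 BX by (auto simp: y_def F_def subset_iff intro!: prod_nonneg prod_le_1)
      then show "bounded (y k ` B)" for k
        using bounded_closed_interval bounded_subset by blast
      show "(\<lambda>k. y k b) \<longlonglongrightarrow> 0" if "b \<in> B" for b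
        by (rule tendsto_eventually, rule eventually_sequentiallyI[of "Suc (to_nat_on B b)"])
           (use finF h(2) that in \<open>auto simp: y_def F_def intro!: prod_zero\<close>)
    qed auto
    have "f k a = 1" for k
    proof -
      have "f k a = y k a"
        by (rule forall_in_closure_of_eq[OF cl _ f y fy]) auto
      then show ?thesis
        using h(3) by (simp add: y_def F_def)
    qed
    then show False
      using f0[OF aX] LIMSEQ_unique[OF _ tendsto_const] by fastforce
  qed
  then obtain U where "openin X U" "a \<in> U" "U \<inter> B = {}"
    using aX unfolding in_closure_of by blast
  then show "\<exists>U. openin X U \<and> U \<inter> A = {a}"
    using a by (intro exI[of _ U]) (auto simp: B_def)
qed

section \<open>Independent linked matrices and weak P-ultrafilters\<close>

text \<open>For a sequence \<open>A\<close> of pairwise disjoint infinite sets, this is the filter of the sets that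
  contain almost all elements of almost all \<open>A j\<close>. The sequence accumulates at every free ultrafilter
  extending it: each member has an infinite intersection with \<open>A j\<close> for infinitely many \<open>j\<close>.\<close>
definition columnwise_cofinite :: "(nat \<Rightarrow> nat set) \<Rightarrow> nat set set" where
  "columnwise_cofinite A = {B. \<forall>\<^sub>F j in sequentially. finite (A j - B)}"

lemma columnwise_cofinite_Inter:
  assumes "finite E" "E \<subseteq> columnwise_cofinite A"
  shows "\<Inter>E \<in> columnwise_cofinite A"
proof -
  have "\<forall>\<^sub>F j in sequentially. \<forall>B\<in>E. finite (A j - B)"
    using assms by (intro eventually_ball_finite) (auto simp: columnwise_cofinite_def)
  then have "\<forall>\<^sub>F j in sequentially. finite (\<Union>B\<in>E. A j - B)"
    by (rule eventually_mono) (use assms(1) in blast)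
  moreover have "A j - \<Inter>E = (\<Union>B\<in>E. A j - B)" for j
    by auto
  ultimately show ?thesis
    by (simp only: columnwise_cofinite_def mem_Collect_eq)
qed

lemma eventually_inj_on_truncation:
  fixes T :: "nat set set"
  assumes "finite T"
  shows "\<forall>\<^sub>F k in sequentially. inj_on (\<lambda>Y. Y \<inter> {..<k}) T"
proof -
  have ev: "\<forall>\<^sub>F k in sequentially. Y \<inter> {..<k} = Z \<inter> {..<k} \<longrightarrow> Y = Z" for Y Z :: "nat set"
  proof (cases "Y = Z")
    case False
    then obtain m where m: "m \<in> Y \<longleftrightarrow> m \<notin> Z"
      by blast
    have "Y \<inter> {..<k} \<noteq> Z \<inter> {..<k}" if "Suc m \<le> k" for k
      using m that by (metis Int_iff Suc_le_eq lessThan_iff)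
    then show ?thesis
      by (intro eventually_sequentiallyI[of "Suc m"] impI) blast
  qed simp
  then have "\<forall>\<^sub>F k in sequentially. \<forall>Y\<in>T. \<forall>Z\<in>T. Y \<inter> {..<k} = Z \<inter> {..<k} \<longrightarrow> Y = Z"
    by (intro eventually_ball_finite ballI assms ev)
  then show ?thesis
    by (simp add: inj_on_def)
qed

text \<open>A matrix \<open>M\<close> of subsets of the natural numbers has entries \<open>M i y n\<close>, where \<open>i\<close> is the row,
  \<open>y\<close> the column and \<open>n\<close> the level. A cell prescribes finitely many columns \<open>s i\<close> in
  each row \<open>i \<in> I\<close> and intersects the entries there, in row \<open>i\<close> at level \<open>card (s i)\<close>.\<close>
definition cell :: "('i \<Rightarrow> 'y \<Rightarrow> nat \<Rightarrow> nat set) \<Rightarrow> 'i set \<Rightarrow> ('i \<Rightarrow> 'y set) \<Rightarrow> nat set" where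
  "cell M I s = (\<Inter>i\<in>I. \<Inter>y\<in>s i. M i y (card (s i)))"

text \<open>The rows in \<open>J\<close> are independent over the filter generated by \<open>G\<close>: every cell with rows in \<open>J\<close>
  meets every member of that filter.\<close>
definition independent_over ::
    "('i \<Rightarrow> 'y \<Rightarrow> nat \<Rightarrow> nat set) \<Rightarrow> nat set set \<Rightarrow> 'i set \<Rightarrow> bool" where
  "independent_over M G J \<longleftrightarrow>
     (\<forall>E I s. finite E \<and> E \<subseteq> G \<and> finite I \<and> I \<subseteq> J \<and> (\<forall>i\<in>I. finite (s i)) \<longrightarrow>
        \<Inter>E \<inter> cell M I s \<noteq> {})"

lemma independent_overD:
  assumes "independent_over M G J" "finite E" "E \<subseteq> G" "finite I" "I \<subseteq> J"
    "\<And>i. i \<in> I \<Longrightarrow> finite (s i)"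
  obtains m where "\<And>B. B \<in> E \<Longrightarrow> m \<in> B" "\<And>i y. i \<in> I \<Longrightarrow> y \<in> s i \<Longrightarrow> m \<in> M i y (card (s i))"
proof -
  have "\<Inter>E \<inter> cell M I s \<noteq> {}"
    by (rule assms(1)[unfolded independent_over_def, rule_format]) (intro conjI ballI assms)
  then obtain m where m: "m \<in> \<Inter>E" "m \<in> cell M I s"
    by blast
  show ?thesis
    by (rule that[of m]) (use m in \<open>auto simp: cell_def\<close>)
qed

text \<open>In every row the entries grow with the level \<open>n\<close>, and any \<open>n + 1\<close> entries at level \<open>n\<close> have
  a finite intersection.\<close>
definition linked_matrix :: "('i \<Rightarrow> 'y \<Rightarrow> nat \<Rightarrow> nat set) \<Rightarrow> bool" where
  "linked_matrix M \<longleftrightarrow>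
     (\<forall>i y. mono (M i y)) \<and>
     (\<forall>i n T. finite T \<and> n < card T \<longrightarrow> finite (\<Inter>y\<in>T. M i y n))"

text \<open>The natural numbers are replaced by pairs \<open>(k, f)\<close>, where \<open>f\<close> is a relation on the subsets of
  \<open>{..<k}\<close>. The pair belongs to the entry for \<open>X\<close>, \<open>Y\<close>, \<open>n\<close> if \<open>f\<close> relates the trace of \<open>X\<close> on
  \<open>{..<k}\<close> to that of \<open>Y\<close> and to at most \<open>n\<close> sets altogether. Since distinct sets have distinct
  traces for large \<open>k\<close>, an intersection of \<open>n + 1\<close> entries involves boundedly many \<open>k\<close> only,
  whereas \<open>f\<close> can be chosen to meet the demands of a cell for every large \<open>k\<close>. A copy of these pairs is
  placed in each \<open>A j\<close>; restricting the copy to \<open>j \<le> k\<close> keeps the intersections finite when all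
  copies are taken together.\<close>
lemma exists_independent_linked_matrix:
  fixes A :: "nat \<Rightarrow> nat set"
  assumes inf: "\<And>j. infinite (A j)" and disj: "disjoint_family A"
  obtains M :: "nat set \<Rightarrow> nat set \<Rightarrow> nat \<Rightarrow> nat set"
  where "linked_matrix M" "independent_over M (columnwise_cofinite A) UNIV"
proof -
  define S :: "(nat \<times> (nat set \<times> nat set) set) set" where
    "S = (SIGMA k:UNIV. Pow (Pow {..<k} \<times> Pow {..<k}))"
  have "countable S"
    unfolding S_def by (intro countable_SIGMA) (auto intro: countable_finite)
  define e where "e j s = enumerate (A j) (to_nat_on S s)" for j s
  have eA: "e j s \<in> A j" for j s
    unfolding e_def by (rule enumerate_in_set[OF inf])
  have e_inj: "j = j' \<and> s = s'" if "e j s = e j' s'" "s \<in> S" "s' \<in> S" for j j' s s'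
  proof -
    have "j = j'"
      using disj eA[of j s] eA[of j' s'] that(1) by (auto simp: disjoint_family_on_def)
    moreover have "to_nat_on S s = to_nat_on S s'"
      using strict_mono_enumerate[OF inf, of j] that(1) \<open>j = j'\<close>
      by (auto simp: e_def dest: strict_mono_eq)
    ultimately show ?thesis
      using that(2,3) \<open>countable S\<close> by simp
  qed
  define Q where "Q X Y n j = {(k, f) \<in> S. j \<le> k \<and> card (f `` {X \<inter> {..<k}}) \<le> n \<and>
                                (X \<inter> {..<k}, Y \<inter> {..<k}) \<in> f}" for X Y :: "nat set" and n j
  define M where "M X Y n = (\<Union>j. e j ` Q X Y n j)" for X Y n
  have "mono (M X Y)" for X Y
    unfolding M_def Q_def by (intro monoI UN_mono image_mono) auto
  moreover have "finite (\<Inter>Y\<in>T. M X Y n)" if T: "finite T" "n < card T" for X n T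
  proof -
    obtain k0 where k0: "\<And>k. k \<ge> k0 \<Longrightarrow> inj_on (\<lambda>Y. Y \<inter> {..<k}) T"
      using eventually_inj_on_truncation[OF T(1)] by (auto simp: eventually_sequentially)
    have "(\<Inter>Y\<in>T. M X Y n) \<subseteq> (\<lambda>(j, s). e j s) ` ({..<k0} \<times> (SIGMA k:{..<k0}. Pow (Pow {..<k} \<times> Pow {..<k})))"
    proof
      fix m assume m: "m \<in> (\<Inter>Y\<in>T. M X Y n)"
      obtain Y0 where "Y0 \<in> T"
        using T by fastforce
      then have "m \<in> M X Y0 n" using m by blast
      then obtain j k f where jkf: "m = e j (k, f)" "(k, f) \<in> Q X Y0 n j"
        unfolding M_def by auto
      then have "(k, f) \<in> S" "j \<le> k" "card (f `` {X \<inter> {..<k}}) \<le> n"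
        by (auto simp: Q_def)
      have "(X \<inter> {..<k}, Y \<inter> {..<k}) \<in> f" if "Y \<in> T" for Y
      proof -
        have "m \<in> M X Y n"
          using m that by blast
        then obtain j' s where "m = e j' s" "s \<in> Q X Y n j'"
          unfolding M_def by blast
        moreover have "s = (k, f)"
          using e_inj[of j' s j "(k, f)"] calculation jkf(1) \<open>(k, f) \<in> S\<close> by (auto simp: Q_def)
        ultimately show ?thesis
          by (auto simp: Q_def)
      qed
      then have sub: "(\<lambda>Y. Y \<inter> {..<k}) ` T \<subseteq> f `` {X \<inter> {..<k}}"
        by auto
      have "finite f"
        using \<open>(k, f) \<in> S\<close> by (auto simp: S_def intro: finite_subset)
      then have "card ((\<lambda>Y. Y \<inter> {..<k}) ` T) \<le> n"
        using card_mono[OF _ sub] \<open>card (f `` {X \<inter> {..<k}}) \<le> n\<close> by (auto intro: order_trans)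
      then have "\<not> inj_on (\<lambda>Y. Y \<inter> {..<k}) T"
        using T(2) by (auto simp: card_image)
      then have "k < k0"
        using k0 not_le by blast
      then show "m \<in> (\<lambda>(j, s). e j s) ` ({..<k0} \<times> (SIGMA k:{..<k0}. Pow (Pow {..<k} \<times> Pow {..<k})))"
        using jkf(1) \<open>j \<le> k\<close> \<open>(k, f) \<in> S\<close> by (intro image_eqI[of _ _ "(j, k, f)"]) (auto simp: S_def)
    qed
    then show ?thesis
      by (rule finite_subset) (auto intro!: finite_imageI finite_SigmaI)
  qed
  ultimately have "linked_matrix M"
    by (auto simp: linked_matrix_def)
  moreover have "independent_over M (columnwise_cofinite A) UNIV"
    unfolding independent_over_def
  proof (intro allI impI, elim conjE)
    fix E I and s :: "nat set \<Rightarrow> nat set set"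
    assume E: "finite E" "E \<subseteq> columnwise_cofinite A" and I: "finite I" and s: "\<forall>i\<in>I. finite (s i)"
    have "\<forall>\<^sub>F j in sequentially. finite (A j - \<Inter>E)"
      using columnwise_cofinite_Inter[OF E] by (simp add: columnwise_cofinite_def)
    then obtain j where j: "finite (A j - \<Inter>E)"
      by (meson eventually_happens' sequentially_bot)
    obtain k0 where k0: "\<And>k. k \<ge> k0 \<Longrightarrow> inj_on (\<lambda>Y. Y \<inter> {..<k}) I"
      using eventually_inj_on_truncation[OF I] by (auto simp: eventually_sequentially)
    define f where "f k = (\<Union>X\<in>I. \<Union>Y\<in>s X. {(X \<inter> {..<k}, Y \<inter> {..<k})})" for k :: nat
    have fS: "(k, f k) \<in> S" for k
      by (auto simp: S_def f_def)
    have fQ: "(k, f k) \<in> Q X Y (card (s X)) j"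
      if k: "k \<ge> k0" "k \<ge> j" and XY: "X \<in> I" "Y \<in> s X" for X Y k
    proof -
      have "f k `` {X \<inter> {..<k}} = (\<lambda>Y. Y \<inter> {..<k}) ` s X"
        using inj_onD[OF k0[OF k(1)]] XY(1) by (auto simp: f_def)
      then have "card (f k `` {X \<inter> {..<k}}) \<le> card (s X)"
        using s XY(1) card_image_le by metis
      then show ?thesis
        using fS XY k(2) by (auto simp: Q_def f_def)
    qed
    have "inj_on (\<lambda>k. e j (k, f k)) {max j k0..}"
      using e_inj fS by (intro inj_onI) blast
    then have "infinite ((\<lambda>k. e j (k, f k)) ` {max j k0..})"
      using finite_imageD infinite_Ici by blast
    then obtain m where "m \<in> (\<lambda>k. e j (k, f k)) ` {max j k0..}" "m \<notin> A j - \<Inter>E"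
      using j by (meson finite_subset subsetI)
    then obtain k where k: "k \<ge> k0" "k \<ge> j" "m = e j (k, f k)" "m \<in> \<Inter>E"
      using eA by auto
    have "m \<in> cell M I s"
      using fQ[OF k(1,2)] k(3) by (auto simp: cell_def M_def)
    then show "\<Inter>E \<inter> cell M I s \<noteq> {}"
      using k(4) by blast
  qed
  ultimately show ?thesis
    by (rule that)
qed

text \<open>The filter generated by \<open>G\<close> has settled the sequence \<open>U\<close>: either it excludes that all \<open>U n\<close> are
  members, or it contains all \<open>U n\<close> together with sets \<open>V y\<close> for uncountably many indices \<open>y\<close>, of which any
  \<open>n + 1\<close> have an intersection almost contained in \<open>U n\<close>. An ultrafilter for which the second
  alternative holds whenever it contains all \<open>U n\<close> is an OK point in the sense of Kunen.\<close>
definition decided :: "nat set set \<Rightarrow> (nat \<Rightarrow> nat set) \<Rightarrow> bool" where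
  "decided G U \<longleftrightarrow>
     (\<exists>E D. finite E \<and> E \<subseteq> G \<and> finite D \<and> D \<subseteq> range U \<and> \<Inter>E \<inter> \<Inter>D = {}) \<or>
     (range U \<subseteq> G \<and> (\<exists>V :: nat set \<Rightarrow> nat set. range V \<subseteq> G \<and>
        (\<forall>n T. finite T \<and> n < card T \<longrightarrow> finite ((\<Inter>y\<in>T. V y) - U n))))"

lemma decided_mono:
  assumes "decided G U" "G \<subseteq> H"
  shows "decided H U"
  using assms unfolding decided_def by (meson subset_trans)

text \<open>One step of the recursion. If adding all \<open>U n\<close> preserves independence, one row \<open>i\<close> is spent on
  the sets \<open>V y\<close>. Otherwise some cell meets some member of the filter in a set disjoint from a
  finite intersection of sets \<open>U n\<close>; adding that cell excludes the sequence and spends finitely many rows.\<close>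
lemma independent_over_decide:
  fixes M :: "'i \<Rightarrow> nat set \<Rightarrow> nat \<Rightarrow> nat set"
  assumes M: "linked_matrix M" and ind: "independent_over M G J" and J: "J \<noteq> {}"
  shows "\<exists>H I. finite I \<and> independent_over M (G \<union> H) (J - I) \<and> decided (G \<union> H) U"
proof (cases "independent_over M (G \<union> range U) J")
  case True
  obtain i where i: "i \<in> J"
    using J by blast
  define V where "V y = {m. \<forall>n. m \<notin> U n \<longrightarrow> m \<in> M i y n}" for y
  have "finite ((\<Inter>y\<in>T. V y) - U n)" if "finite T" "n < card T" for n T
  proof (rule finite_subset)
    show "(\<Inter>y\<in>T. V y) - U n \<subseteq> (\<Inter>y\<in>T. M i y n)"
      by (auto simp: V_def)
    show "finite (\<Inter>y\<in>T. M i y n)"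
      using M that by (auto simp: linked_matrix_def)
  qed
  then have "decided (G \<union> (range U \<union> range V)) U"
    unfolding decided_def by (intro disjI2 conjI exI[of _ V]) auto
  moreover have "independent_over M (G \<union> (range U \<union> range V)) (J - {i})"
    unfolding independent_over_def
  proof (intro allI impI, elim conjE)
    fix E I and s :: "'i \<Rightarrow> nat set set"
    assume E: "finite E" "E \<subseteq> G \<union> (range U \<union> range V)" and I: "finite I" "I \<subseteq> J - {i}"
      and s: "\<forall>i\<in>I. finite (s i)"
    have "finite (E - (G \<union> range U))" "E - (G \<union> range U) \<subseteq> V ` UNIV"
      using E by auto
    then obtain T where T: "finite T" "E - (G \<union> range U) = V ` T"
      by (meson finite_subset_image)
    obtain m where m: "\<And>B. B \<in> (E \<inter> (G \<union> range U)) \<union> U ` {..<card T} \<Longrightarrow> m \<in> B"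
      "\<And>i' y. i' \<in> insert i I \<Longrightarrow> y \<in> (s(i := T)) i' \<Longrightarrow> m \<in> M i' y (card ((s(i := T)) i'))"
    proof (rule independent_overD[OF True])
      show "finite (E \<inter> (G \<union> range U) \<union> U ` {..<card T})"
        using E by simp
      show "finite (insert i I)" "insert i I \<subseteq> J"
        using I i by auto
      show "finite ((s(i := T)) i')" if "i' \<in> insert i I" for i'
        using that T s by auto
    qed auto
    \<comment> \<open>Below level \<open>card T\<close> the point \<open>m\<close> lies in \<open>U n\<close>; from there on the entries only grow.\<close>
    have "m \<in> V y" if y: "y \<in> T" for y
      unfolding V_def
    proof (intro CollectI allI impI)
      fix n assume "m \<notin> U n"
      then have "card T \<le> n"
        using m(1)[of "U n"] by force
      moreover have "m \<in> M i y (card T)"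
        using m(2)[of i y] y by simp
      moreover have "mono (M i y)"
        using M by (simp add: linked_matrix_def)
      ultimately show "m \<in> M i y n"
        by (meson monoD subsetD)
    qed
    then have "m \<in> \<Inter>E"
      using m(1) T(2) by blast
    moreover have "m \<in> cell M I s"
      unfolding cell_def
    proof (intro INT_I)
      fix i' y assume "i' \<in> I" "y \<in> s i'"
      moreover from this have "i' \<noteq> i"
        using I by blast
      ultimately show "m \<in> M i' y (card (s i'))"
        using m(2)[of i' y] by simp
    qed
    ultimately show "\<Inter>E \<inter> cell M I s \<noteq> {}"
      by blast
  qed
  ultimately show ?thesis
    by (intro exI[of _ "range U \<union> range V"] exI[of _ "{i}"]) auto
next
  case False
  then obtain E I s where E: "finite E" "E \<subseteq> G \<union> range U" and I: "finite I" "I \<subseteq> J"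
    and s: "\<forall>i\<in>I. finite (s i)" and empty: "\<Inter>E \<inter> cell M I s = {}"
    unfolding independent_over_def by (simp only: not_all not_imp not_not) (elim exE conjE, rule that)
  have "E \<inter> G \<union> E \<inter> range U = E"
    using E(2) by auto
  then have "\<Inter>(insert (cell M I s) (E \<inter> G)) \<inter> \<Inter>(E \<inter> range U) = cell M I s \<inter> \<Inter>E"
    by (metis Inter_Un_distrib Inter_insert Int_assoc)
  then have "\<Inter>(insert (cell M I s) (E \<inter> G)) \<inter> \<Inter>(E \<inter> range U) = {}"
    using empty by (simp add: Int_commute)
  then have "decided (G \<union> {cell M I s}) U"
    unfolding decided_def using E
    by (intro disjI1 exI[of _ "insert (cell M I s) (E \<inter> G)"] exI[of _ "E \<inter> range U"]) auto
  moreover have "independent_over M (G \<union> {cell M I s}) (J - I)"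
    unfolding independent_over_def
  proof (intro allI impI, elim conjE)
    fix E' I' and s' :: "'i \<Rightarrow> nat set set"
    assume E': "finite E'" "E' \<subseteq> G \<union> {cell M I s}" and I': "finite I'" "I' \<subseteq> J - I"
      and s': "\<forall>i\<in>I'. finite (s' i)"
    \<comment> \<open>The new cell and the given one use disjoint sets of rows, so together they form a single cell.\<close>
    define t where "t i = (if i \<in> I then s i else s' i)" for i
    obtain m where m: "\<And>B. B \<in> E' \<inter> G \<Longrightarrow> m \<in> B"
      "\<And>i y. i \<in> I \<union> I' \<Longrightarrow> y \<in> t i \<Longrightarrow> m \<in> M i y (card (t i))"
    proof (rule independent_overD[OF ind])
      show "finite (E' \<inter> G)" using E' by simp
      show "finite (I \<union> I')" "I \<union> I' \<subseteq> J"
        using I I' by auto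
      show "finite (t i)" if "i \<in> I \<union> I'" for i
        using that s s' by (auto simp: t_def)
    qed auto
    have "m \<in> M i y (card (s i))" if "i \<in> I" "y \<in> s i" for i y
      using m(2)[of i y] that by (simp add: t_def)
    then have "m \<in> cell M I s"
      by (auto simp: cell_def)
    moreover have "m \<in> M i y (card (s' i))" if "i \<in> I'" "y \<in> s' i" for i y
      using m(2)[of i y] that I' by (auto simp: t_def split: if_splits)
    then have "m \<in> cell M I' s'"
      by (auto simp: cell_def)
    ultimately show "\<Inter>E' \<inter> cell M I' s' \<noteq> {}"
      using m(1) E'(2) by blast
  qed
  ultimately show ?thesis
    using I(1) by blast
qed

text \<open>Transfinite recursion over all sequences of sets, coded by \<open>prod_encode\<close> as single sets and
  well-ordered in the order type of the continuum. Each step spends finitely many rows, so fewer rows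
  than there are have been spent before any given step. The pairs consist of the sets added and the rows
  spent.\<close>
lemma exists_deciding_family:
  includes cardinal_syntax
  fixes M :: "nat set \<Rightarrow> nat set \<Rightarrow> nat \<Rightarrow> nat set"
  assumes M: "linked_matrix M" and ind: "independent_over M F UNIV"
  obtains G where "F \<subseteq> G" "\<And>E. finite E \<Longrightarrow> E \<subseteq> G \<Longrightarrow> \<Inter>E \<noteq> {}" "\<And>U. decided G U"
proof -
  define r where "r = |UNIV :: nat set set|"
  have r_card: "Card_order r"
    unfolding r_def by (rule card_of_Card_order)
  have r_field: "Field r = UNIV"
    unfolding r_def by (rule Field_card_of)
  have r_wo: "Well_order r"
    using r_card by (rule card_order_on_well_order_on)
  have r_total: "(x, y) \<in> r \<or> (y, x) \<in> r" for x y
    using r_wo r_field wo_rel.TOTALS[of r] by (auto simp: wo_rel_def)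
  have r_trans: "trans r"
    using r_wo wo_rel.TRANS[of r] by (auto simp: wo_rel_def)
  have r_antisym: "antisym r"
    using r_wo wo_rel.ANTISYM[of r] by (auto simp: wo_rel_def)
  define U where "U R n = {m. prod_encode (n, m) \<in> R}" for R n
  define P where "P f x p \<longleftrightarrow>
      finite (snd p) \<and>
      independent_over M (F \<union> (\<Union>y\<in>underS r x. fst (f y)) \<union> fst p)
        (UNIV - (\<Union>y\<in>underS r x. snd (f y)) - snd p) \<and>
      decided (F \<union> (\<Union>y\<in>underS r x. fst (f y)) \<union> fst p) (U x)"
    for f :: "nat set \<Rightarrow> nat set set \<times> nat set set" and x p
  \<comment> \<open>Independence passes to unions of the chain: a finite set of generators appears at some step.\<close>
  have union: "independent_over M (F \<union> (\<Union>y\<in>K. fst (f y))) (UNIV - (\<Union>y\<in>K. snd (f y)))"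
    if K: "\<And>y. y \<in> K \<Longrightarrow> underS r y \<subseteq> K" and f: "\<And>y. y \<in> K \<Longrightarrow> P f y (f y)" for f K
  proof (cases "K = {}")
    case True
    then show ?thesis using ind by simp
  next
    case False
    show ?thesis
      unfolding independent_over_def
    proof (intro allI impI, elim conjE)
      fix E I and s :: "nat set \<Rightarrow> nat set set"
      assume E: "finite E" "E \<subseteq> F \<union> (\<Union>y\<in>K. fst (f y))"
        and I: "finite I" "I \<subseteq> UNIV - (\<Union>y\<in>K. snd (f y))" and s: "\<forall>i\<in>I. finite (s i)"
      have "\<exists>y\<in>K. E \<subseteq> F \<union> (\<Union>z\<in>under r y. fst (f z))"
        using E
      proof (induction E)
        case empty
        then show ?case using False by auto
      next
        case (insert B E)
        then obtain y where y: "y \<in> K" "E \<subseteq> F \<union> (\<Union>z\<in>under r y. fst (f z))"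
          by auto
        show ?case
        proof (cases "B \<in> F")
          case True
          then show ?thesis using y by auto
        next
          case False
          then obtain z where z: "z \<in> K" "B \<in> fst (f z)"
            using insert.prems by auto
          have zz: "z \<in> under r z"
            using r_total[of z z] by (simp add: under_def)
          show ?thesis
          proof (cases "(y, z) \<in> r")
            case True
            then have "under r y \<subseteq> under r z"
              by (rule under_incr[OF r_trans])
            then show ?thesis
              using y z zz by (intro bexI[of _ z]) auto
          next
            case False
            then have "z \<in> under r y"
              using r_total by (auto simp: under_def)
            then show ?thesis
              using y z by (intro bexI[of _ y]) auto
          qed
        qed
      qed
      then obtain y where y: "y \<in> K" "E \<subseteq> F \<union> (\<Union>z\<in>under r y. fst (f z))"
        by blast
      have under: "under r y = insert y (underS r y)"
        using r_total[of y y] by (auto simp: under_def underS_def)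
      have "independent_over M (F \<union> (\<Union>z\<in>underS r y. fst (f z)) \<union> fst (f y))
              (UNIV - (\<Union>z\<in>underS r y. snd (f z)) - snd (f y))"
        using f[OF y(1)] by (simp add: P_def)
      moreover have "E \<subseteq> F \<union> (\<Union>z\<in>underS r y. fst (f z)) \<union> fst (f y)"
        using y(2) under by auto
      moreover have "I \<subseteq> UNIV - (\<Union>z\<in>underS r y. snd (f z)) - snd (f y)"
        using I(2) K[OF y(1)] y(1) by auto
      ultimately show "\<Inter>E \<inter> cell M I s \<noteq> {}"
        using E(1) I(1) s unfolding independent_over_def by blast
    qed
  qed
  have "\<exists>f. \<forall>x. P f x (f x)"
  proof (rule dependent_wf_choice)
    show "wf (r - Id)"
      using r_wo by (simp add: well_order_on_def)
    show "P f x p = P g x p" if "\<And>z. (z, x) \<in> r - Id \<Longrightarrow> f z = g z" for f g x p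
    proof -
      have "f z = g z" if "z \<in> underS r x" for z
        using that \<open>\<And>z. (z, x) \<in> r - Id \<Longrightarrow> f z = g z\<close> by (simp add: underS_def)
      then show ?thesis
        by (simp add: P_def)
    qed
    fix x f
    assume "\<And>y. (y, x) \<in> r - Id \<Longrightarrow> P f y (f y)"
    then have f: "P f y (f y)" if "y \<in> underS r x" for y
      using that by (simp add: underS_def)
    have "underS r y \<subseteq> underS r x" if "y \<in> underS r x" for y
      using that r_trans r_antisym unfolding underS_def by (auto dest: transD antisymD)
    then have ind': "independent_over M (F \<union> (\<Union>y\<in>underS r x. fst (f y)))
        (UNIV - (\<Union>y\<in>underS r x. snd (f y)))"
      using f by (intro union)
    have fin: "finite (snd (f y))" if "y \<in> underS r x" for y
      using f[OF that] by (simp add: P_def)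
    have "(\<Union>y\<in>underS r x. snd (f y)) \<noteq> UNIV"
    proof (cases "finite (underS r x)")
      case True
      then have "finite (\<Union>y\<in>underS r x. snd (f y))"
        using fin by blast
      then show ?thesis
        using Finite_Set.finite_set infinite_UNIV_nat by metis
    next
      case False
      have "|snd (f y)| \<le>o |underS r x|" if "y \<in> underS r x" for y
        using False fin[OF that] by (intro ordLess_imp_ordLeq finite_ordLess_infinite)
          (auto simp: Field_card_of card_of_well_order_on)
      then have "|\<Union>y\<in>underS r x. snd (f y)| \<le>o |underS r x|"
        using False by (intro card_of_UNION_ordLeq_infinite ballI card_of_mono1[OF subset_refl])
      also have "|underS r x| <o r"
        by (rule card_of_underS[OF r_card]) (simp add: r_field)
      finally show ?thesis
        using ordLess_irreflexive unfolding r_def by metis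
    qed
    then have "UNIV - (\<Union>y\<in>underS r x. snd (f y)) \<noteq> {}"
      by blast
    then obtain H I where "finite I"
      "independent_over M (F \<union> (\<Union>y\<in>underS r x. fst (f y)) \<union> H)
         (UNIV - (\<Union>y\<in>underS r x. snd (f y)) - I)"
      "decided (F \<union> (\<Union>y\<in>underS r x. fst (f y)) \<union> H) (U x)"
      using independent_over_decide[OF M ind'] by blast
    then show "\<exists>p. P f x p"
      by (intro exI[of _ "(H, I)"]) (simp add: P_def)
  qed
  then obtain f where f: "\<And>x. P f x (f x)"
    by blast
  define G where "G = F \<union> (\<Union>y. fst (f y))"
  show ?thesis
  proof
    show "F \<subseteq> G"
      by (auto simp: G_def)
    have "independent_over M G (UNIV - (\<Union>y. snd (f y)))"
      unfolding G_def using f by (intro union) auto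
    then show "\<Inter>E \<noteq> {}" if "finite E" "E \<subseteq> G" for E
      using that independent_overD[of M G _ E "{}"] by (metis Inter_iff empty_iff empty_subsetI finite.emptyI)
    show "decided G W" for W
    proof -
      define x where "x = {prod_encode (n, m) | n m. m \<in> W n}"
      have "U x = W"
        by (auto simp: U_def x_def fun_eq_iff)
      moreover have "decided G (U x)"
        using f[of x] unfolding P_def by (auto simp: G_def intro: decided_mono)
      ultimately show ?thesis by simp
    qed
  qed
qed

text \<open>Ultrafilters on the natural numbers all of whose members are infinite.\<close>
definition free_ultrafilter :: "nat set set \<Rightarrow> bool" where
  "free_ultrafilter p \<longleftrightarrow>
     (\<forall>B\<in>p. \<forall>C. B \<subseteq> C \<longrightarrow> C \<in> p) \<and> (\<forall>B\<in>p. \<forall>C\<in>p. B \<inter> C \<in> p) \<and>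
     (\<forall>B. B \<in> p \<longleftrightarrow> - B \<notin> p) \<and> (\<forall>B\<in>p. infinite B)"

text \<open>The combinatorial form of a weak P-point: a free ultrafilter with a member that belongs to none
  of countably many given other free ultrafilters.\<close>
definition weak_P_ultrafilter :: "nat set set \<Rightarrow> bool" where
  "weak_P_ultrafilter p \<longleftrightarrow>
     free_ultrafilter p \<and>
     (\<forall>C. countable C \<and> (\<forall>c\<in>C. free_ultrafilter c) \<and> p \<notin> C \<longrightarrow> (\<exists>B\<in>p. \<forall>c\<in>C. B \<notin> c))"

lemma free_ultrafilter_mono:
  assumes "free_ultrafilter p" "B \<in> p" "B \<subseteq> C"
  shows "C \<in> p"
proof -
  have "\<forall>B\<in>p. \<forall>C. B \<subseteq> C \<longrightarrow> C \<in> p"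
    using assms(1) unfolding free_ultrafilter_def by (elim conjE)
  with assms(2,3) show ?thesis by simp
qed

lemma free_ultrafilter_Int:
  assumes "free_ultrafilter p" "B \<in> p" "C \<in> p"
  shows "B \<inter> C \<in> p"
proof -
  have "\<forall>B\<in>p. \<forall>C\<in>p. B \<inter> C \<in> p"
    using assms(1) unfolding free_ultrafilter_def by (elim conjE)
  with assms(2,3) show ?thesis by simp
qed

lemma free_ultrafilter_Compl:
  assumes "free_ultrafilter p"
  shows "- B \<in> p \<longleftrightarrow> B \<notin> p"
proof -
  have "\<forall>B. B \<in> p \<longleftrightarrow> - B \<notin> p"
    using assms(1) unfolding free_ultrafilter_def by (elim conjE)
  from this[rule_format, of B] show ?thesis by blast
qed

lemma free_ultrafilter_infinite:
  assumes "free_ultrafilter p" "B \<in> p"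
  shows "infinite B"
proof -
  have "\<forall>B\<in>p. infinite B"
    using assms(1) unfolding free_ultrafilter_def by (elim conjE)
  with assms(2) show ?thesis by simp
qed

lemma free_ultrafilter_INT:
  assumes "free_ultrafilter p" "finite T" "\<And>y. y \<in> T \<Longrightarrow> V y \<in> p"
  shows "(\<Inter>y\<in>T. V y) \<in> p"
  using assms(2,3)
proof (induction T)
  case empty
  have "UNIV \<in> p"
    using free_ultrafilter_Compl[OF assms(1), of UNIV] free_ultrafilter_infinite[OF assms(1), of "{}"]
    by auto
  then show ?case by simp
next
  case (insert y T)
  then show ?case
    using free_ultrafilter_Int[OF assms(1)] by simp
qed

lemma free_ultrafilter_distinct:
  assumes "free_ultrafilter p" "free_ultrafilter c" "c \<noteq> p"
  shows "\<exists>B\<in>p. B \<notin> c"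
proof (rule ccontr)
  assume "\<not> (\<exists>B\<in>p. B \<notin> c)"
  then have "p \<subseteq> c" by blast
  moreover have "c \<subseteq> p"
    using free_ultrafilter_Compl assms(1,2) \<open>p \<subseteq> c\<close> by blast
  ultimately show False
    using assms(3) by blast
qed

lemma uncountable_UNIV_nat_set: "uncountable (UNIV :: nat set set)"
proof
  assume "countable (UNIV :: nat set set)"
  then have "range (from_nat_into (UNIV :: nat set set)) = Pow UNIV"
    by (simp add: range_from_nat_into)
  then show False
    using Cantors_theorem by metis
qed

text \<open>OK points are weak P-points. Choose members \<open>U n\<close> of \<open>p\<close> such that the \<open>n\<close>-th of the given
  ultrafilters omits \<open>U n\<close>. That ultrafilter contains at most \<open>n\<close> of the sets \<open>V y\<close>, so all but countably
  many \<open>V y\<close> belong to none of them.\<close>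
lemma weak_P_ultrafilterI:
  assumes p: "free_ultrafilter p"
    and OK: "\<And>U. range U \<subseteq> p \<Longrightarrow> \<exists>V :: nat set \<Rightarrow> nat set. range V \<subseteq> p \<and>
               (\<forall>n T. finite T \<and> n < card T \<longrightarrow> finite ((\<Inter>y\<in>T. V y) - U n))"
  shows "weak_P_ultrafilter p"
  unfolding weak_P_ultrafilter_def
proof (intro conjI allI impI p, elim conjE)
  fix C assume C: "countable C" "\<forall>c\<in>C. free_ultrafilter c" "p \<notin> C"
  have "\<forall>c\<in>C. \<exists>B\<in>p. B \<notin> c"
    using free_ultrafilter_distinct[OF p] C by metis
  then obtain W where W: "\<And>c. c \<in> C \<Longrightarrow> W c \<in> p" "\<And>c. c \<in> C \<Longrightarrow> W c \<notin> c"
    by metis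
  have "UNIV \<in> p"
    using free_ultrafilter_INT[OF p, of "{}"] by simp
  define U where "U n = (if n \<in> to_nat_on C ` C then W (from_nat_into C n) else UNIV)" for n
  have U: "U (to_nat_on C c) = W c" if "c \<in> C" for c
    using that C(1) by (simp add: U_def)
  have "range U \<subseteq> p"
    using W(1) \<open>UNIV \<in> p\<close> C(1) by (auto simp: U_def)
  then obtain V :: "nat set \<Rightarrow> nat set" where "range V \<subseteq> p"
    and V': "\<forall>n T. finite T \<and> n < card T \<longrightarrow> finite ((\<Inter>y\<in>T. V y) - U n)"
    using OK by blast
  then have V: "V y \<in> p" for y
    by blast
  have fin: "finite ((\<Inter>y\<in>T. V y) - U n)" if "finite T" "n < card T" for n T
    using V' that by simp
  have "finite {y. V y \<in> c}" if c: "c \<in> C" for c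
  proof (rule ccontr)
    assume "infinite {y. V y \<in> c}"
    then obtain T where T: "finite T" "card T = Suc (to_nat_on C c)" "T \<subseteq> {y. V y \<in> c}"
      using infinite_arbitrarily_large by blast
    have fc: "free_ultrafilter c"
      using C(2) c by blast
    have "(\<Inter>y\<in>T. V y) \<in> c"
      using free_ultrafilter_INT[OF fc T(1)] T(3) by blast
    moreover have "- W c \<in> c"
      using W(2)[OF c] free_ultrafilter_Compl[OF fc] by blast
    ultimately have "(\<Inter>y\<in>T. V y) \<inter> - W c \<in> c"
      by (rule free_ultrafilter_Int[OF fc])
    then have "infinite ((\<Inter>y\<in>T. V y) \<inter> - W c)"
      by (rule free_ultrafilter_infinite[OF fc])
    moreover have "finite ((\<Inter>y\<in>T. V y) - U (to_nat_on C c))"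
      using T by (intro fin) auto
    ultimately show False
      using U[OF c] by (simp add: Diff_eq)
  qed
  then have "countable (\<Union>c\<in>C. {y. V y \<in> c})"
    using C(1) by (auto intro: countable_finite)
  then have "(\<Union>c\<in>C. {y. V y \<in> c}) \<noteq> UNIV"
    using uncountable_UNIV_nat_set by metis
  then show "\<exists>B\<in>p. \<forall>c\<in>C. B \<notin> c"
    using V by blast
qed

text \<open>Kunen's theorem, with the addition that the weak P-point may be chosen above a prescribed filter
  of the form \<^const>\<open>columnwise_cofinite\<close>.\<close>
theorem exists_weak_P_ultrafilter:
  fixes A :: "nat \<Rightarrow> nat set"
  assumes "\<And>j. infinite (A j)" "disjoint_family A"
  obtains p where "weak_P_ultrafilter p" "columnwise_cofinite A \<subseteq> p"
proof -
  obtain M :: "nat set \<Rightarrow> nat set \<Rightarrow> nat \<Rightarrow> nat set"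
    where "linked_matrix M" "independent_over M (columnwise_cofinite A) UNIV"
    using exists_independent_linked_matrix[OF assms] .
  then obtain G where G: "columnwise_cofinite A \<subseteq> G"
    and fip: "\<And>E. finite E \<Longrightarrow> E \<subseteq> G \<Longrightarrow> \<Inter>E \<noteq> {}" and dec: "\<And>U. decided G U"
    using exists_deciding_family by blast
  define p where "p = {B. \<exists>E. finite E \<and> E \<subseteq> G \<and> \<Inter>E \<subseteq> B}"
  have Gp: "G \<subseteq> p"
    unfolding p_def by (auto intro: exI[of _ "{_}"])
  have up: "C \<in> p" if "B \<in> p" "B \<subseteq> C" for B C
    using that unfolding p_def by blast
  have int: "B \<inter> C \<in> p" if BC: "B \<in> p" "C \<in> p" for B C
  proof -
    obtain E E' where "finite E" "E \<subseteq> G" "\<Inter>E \<subseteq> B" "finite E'" "E' \<subseteq> G" "\<Inter>E' \<subseteq> C"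
      using BC unfolding p_def by blast
    then show ?thesis
      unfolding p_def by (intro CollectI exI[of _ "E \<union> E'"]) auto
  qed
  have ne: "{} \<notin> p"
    using fip unfolding p_def by blast
  have ultra: "B \<in> p \<or> - B \<in> p" for B
  proof -
    \<comment> \<open>Deciding the constant sequence of value \<open>B\<close> decides \<open>B\<close>.\<close>
    from dec[of "\<lambda>_. B"] show ?thesis
      unfolding decided_def
    proof (elim disjE exE conjE)
      fix E D assume neg: "finite E" "E \<subseteq> G" "D \<subseteq> range (\<lambda>_. B)" "\<Inter>E \<inter> \<Inter>D = {}"
      then have "\<Inter>E \<subseteq> - B"
        by blast
      then show ?thesis
        using neg unfolding p_def by blast
    next
      assume "range (\<lambda>_. B) \<subseteq> G"
      then show ?thesis using Gp by blast
    qed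
  qed
  have inf: "infinite B" if "B \<in> p" for B
  proof
    assume "finite B"
    then have "- B \<in> columnwise_cofinite A"
      by (simp add: columnwise_cofinite_def Diff_eq)
    then have "- B \<in> p"
      using G Gp by blast
    then show False
      using int[OF that] ne by fastforce
  qed
  have p: "free_ultrafilter p"
    unfolding free_ultrafilter_def
  proof (intro conjI ballI allI impI)
    show "B \<in> p \<longleftrightarrow> - B \<notin> p" for B
      using ultra int[of B "- B"] ne by auto
  qed (use up int inf in blast)+
  have "weak_P_ultrafilter p"
  proof (rule weak_P_ultrafilterI[OF p])
    fix U :: "nat \<Rightarrow> nat set" assume U: "range U \<subseteq> p"
    have "\<Inter>E \<inter> \<Inter>D \<noteq> {}" if "finite E" "E \<subseteq> G" "finite D" "D \<subseteq> range U" for E D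
    proof -
      have "(\<Inter>B\<in>E \<union> D. B) \<in> p"
        using that Gp U by (intro free_ultrafilter_INT[OF p]) auto
      then show ?thesis
        using ne by (metis Inter_Un_distrib image_ident)
    qed
    then obtain V :: "nat set \<Rightarrow> nat set" where "range V \<subseteq> G"
        "\<forall>n T. finite T \<and> n < card T \<longrightarrow> finite ((\<Inter>y\<in>T. V y) - U n)"
      using dec[of U] unfolding decided_def by blast
    then show "\<exists>V :: nat set \<Rightarrow> nat set. range V \<subseteq> p \<and>
               (\<forall>n T. finite T \<and> n < card T \<longrightarrow> finite ((\<Inter>y\<in>T. V y) - U n))"
      using Gp by blast
  qed
  then show ?thesis
    using that G Gp by blast
qed

section \<open>Points of the Stone-Cech remainder as ultrafilters\<close>

abbreviation beta_omega :: "((nat \<Rightarrow> real) \<Rightarrow> real) topology" where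
  "beta_omega \<equiv> stone_cech (discrete_topology UNIV)"

abbreviation omega_embed :: "nat \<Rightarrow> (nat \<Rightarrow> real) \<Rightarrow> real" where
  "omega_embed \<equiv> stone_cech_embed (discrete_topology UNIV)"

abbreviation omega_cube :: "((nat \<Rightarrow> real) \<Rightarrow> real) topology" where
  "omega_cube \<equiv> product_topology (\<lambda>_. top_of_set {0..1}) (unit_maps (discrete_topology UNIV))"

lemma unit_maps_nat: "unit_maps (discrete_topology (UNIV :: nat set)) = {f. \<forall>n. 0 \<le> f n \<and> f n \<le> 1}"
  by (auto simp: unit_maps_def extensional_def Pi_iff)

lemma beta_omega_eq: "beta_omega = subtopology omega_cube (omega_cube closure_of range omega_embed)"
  by (simp add: stone_cech_def Let_def)

lemma range_omega_embed_subset: "range omega_embed \<subseteq> topspace omega_cube"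
proof
  fix q assume "q \<in> range omega_embed"
  then obtain n where "q = omega_embed n"
    by blast
  then show "q \<in> topspace omega_cube"
    by (simp add: stone_cech_embed_def PiE_iff) (simp add: unit_maps_nat)
qed

lemma topspace_beta_omega: "topspace beta_omega = omega_cube closure_of range omega_embed"
  unfolding beta_omega_eq topspace_subtopology
  using closure_of_subset_topspace by (metis inf.absorb2)

lemma beta_omega_dense: "topspace beta_omega = beta_omega closure_of range omega_embed"
proof -
  have "range omega_embed \<subseteq> omega_cube closure_of range omega_embed"
    by (rule closure_of_subset[OF range_omega_embed_subset])
  then show ?thesis
    unfolding topspace_beta_omega unfolding beta_omega_eq
    by (simp add: closure_of_subtopology_open)
qed

lemma compact_space_beta_omega: "compact_space beta_omega"
proof -
  have "compact_space omega_cube"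
    by (simp add: compact_space_product_topology compact_space_subtopology)
  then have "compactin omega_cube (omega_cube closure_of range omega_embed)"
    by (intro closedin_compact_space closedin_closure_of)
  then show ?thesis
    unfolding beta_omega_eq by (rule compact_space_subtopology)
qed

lemma continuous_map_beta_omega_coord:
  assumes "f \<in> unit_maps (discrete_topology UNIV)"
  shows "continuous_map beta_omega euclideanreal (\<lambda>p. p f)"
proof -
  have "continuous_map omega_cube (top_of_set {0..1}) (\<lambda>p. p f)"
    by (rule continuous_map_product_projection[OF assms])
  then show ?thesis
    unfolding beta_omega_eq
    by (simp add: continuous_map_in_subtopology continuous_map_from_subtopology)
qed

lemma beta_omega_coord_bounds:
  assumes "f \<in> unit_maps (discrete_topology UNIV)" "p \<in> topspace beta_omega"
  shows "0 \<le> p f" "p f \<le> 1"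
proof -
  have "p \<in> topspace omega_cube"
    using assms(2) by (simp add: beta_omega_eq)
  then show "0 \<le> p f" "p f \<le> 1"
    using assms(1) by (auto simp: PiE_iff)
qed

text \<open>Identities between continuous functions hold on the whole compactification as soon as they hold
  at the natural numbers. The lemmas below state properties of ultrafilters as such identities.\<close>
lemma beta_omega_eq_on_dense:
  fixes h :: "((nat \<Rightarrow> real) \<Rightarrow> real) \<Rightarrow> real"
  assumes "continuous_map beta_omega euclideanreal h"
    and "\<And>n. h (omega_embed n) = 0" and "p \<in> topspace beta_omega"
  shows "h p = 0"
proof -
  have "p \<in> beta_omega closure_of range omega_embed"
    by (rule equalityD1[OF beta_omega_dense, THEN subsetD, OF assms(3)])
  then show ?thesis
  proof (rule forall_in_closure_of_eq[where Y = euclideanreal])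
    show "h q = 0" if "q \<in> range omega_embed" for q
      using that assms(2) by blast
  qed (simp_all add: assms(1))
qed

lemma indicator_in_unit_maps: "indicator B \<in> unit_maps (discrete_topology (UNIV :: nat set))"
  by (auto simp: unit_maps_nat indicator_def)

lemma omega_embed_apply: "f \<in> unit_maps (discrete_topology UNIV) \<Longrightarrow> omega_embed n f = f n"
  by (simp add: stone_cech_embed_def)

text \<open>The sets whose indicator function extends to the value \<open>1\<close> at \<open>p\<close>, that is, whose closure
  contains \<open>p\<close>.\<close>
definition ultrafilter_of :: "((nat \<Rightarrow> real) \<Rightarrow> real) \<Rightarrow> nat set set" where
  "ultrafilter_of p = {B. p (indicator B) = 1}"

lemma beta_omega_indicator:
  assumes p: "p \<in> topspace beta_omega"
  shows "p (indicator B) = (if B \<in> ultrafilter_of p then 1 else 0)"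
proof -
  have "p (indicator B) * (1 - p (indicator B)) = 0"
    by (rule beta_omega_eq_on_dense[OF _ _ p, where h = "\<lambda>p. p (indicator B) * (1 - p (indicator B))"])
       (auto intro!: continuous_intros continuous_map_beta_omega_coord
          simp: indicator_in_unit_maps omega_embed_apply indicator_def)
  then show ?thesis
    by (auto simp: ultrafilter_of_def)
qed

lemma ultrafilter_of_Int:
  assumes p: "p \<in> topspace beta_omega"
  shows "B \<inter> C \<in> ultrafilter_of p \<longleftrightarrow> B \<in> ultrafilter_of p \<and> C \<in> ultrafilter_of p"
proof -
  have "p (indicator (B \<inter> C)) - p (indicator B) * p (indicator C) = 0"
    by (rule beta_omega_eq_on_dense[OF _ _ p,
          where h = "\<lambda>p. p (indicator (B \<inter> C)) - p (indicator B) * p (indicator C)"])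
       (auto intro!: continuous_intros continuous_map_beta_omega_coord
          simp: indicator_in_unit_maps omega_embed_apply indicator_def)
  then show ?thesis
    using beta_omega_indicator[OF p] by (auto split: if_splits)
qed

lemma ultrafilter_of_Compl:
  assumes p: "p \<in> topspace beta_omega"
  shows "- B \<in> ultrafilter_of p \<longleftrightarrow> B \<notin> ultrafilter_of p"
proof -
  have "p (indicator (- B)) - (1 - p (indicator B)) = 0"
    by (rule beta_omega_eq_on_dense[OF _ _ p,
          where h = "\<lambda>p. p (indicator (- B)) - (1 - p (indicator B))"])
       (auto intro!: continuous_intros continuous_map_beta_omega_coord
          simp: indicator_in_unit_maps omega_embed_apply indicator_def)
  then show ?thesis
    using beta_omega_indicator[OF p, of B] beta_omega_indicator[OF p, of "- B"] by (auto split: if_splits)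
qed

lemma ultrafilter_of_close:
  assumes p: "p \<in> topspace beta_omega" and f: "f \<in> unit_maps (discrete_topology UNIV)"
    and B: "{n. \<bar>f n - c\<bar> < e} \<in> ultrafilter_of p"
  shows "\<bar>p f - c\<bar> \<le> e"
proof -
  let ?B = "{n. \<bar>f n - c\<bar> < e}"
  have "p (indicator ?B) * max 0 (\<bar>p f - c\<bar> - e) = 0"
    by (rule beta_omega_eq_on_dense[OF _ _ p, where h = "\<lambda>p. p (indicator ?B) * max 0 (\<bar>p f - c\<bar> - e)"])
       (auto intro!: continuous_intros continuous_map_beta_omega_coord f
          simp: indicator_in_unit_maps omega_embed_apply[OF f] omega_embed_apply[OF indicator_in_unit_maps] indicator_def)
  then show ?thesis
    using B by (auto simp: ultrafilter_of_def max_def split: if_splits)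
qed

lemma close_in_ultrafilter_of:
  assumes p: "p \<in> topspace beta_omega" and f: "f \<in> unit_maps (discrete_topology UNIV)" and "0 < e"
  shows "{n. \<bar>f n - p f\<bar> < e} \<in> ultrafilter_of p"
proof -
  define c where "c = p f"
  let ?B = "{n. \<bar>f n - c\<bar> < e}"
  have "(1 - p (indicator ?B)) * max 0 (e - \<bar>p f - c\<bar>) = 0"
    by (rule beta_omega_eq_on_dense[OF _ _ p, where h = "\<lambda>p. (1 - p (indicator ?B)) * max 0 (e - \<bar>p f - c\<bar>)"])
       (auto intro!: continuous_intros continuous_map_beta_omega_coord f
          simp: indicator_in_unit_maps omega_embed_apply[OF f] omega_embed_apply[OF indicator_in_unit_maps] indicator_def)
  then show ?thesis
    using \<open>0 < e\<close> by (simp add: ultrafilter_of_def c_def)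
qed

lemma ultrafilter_of_inj:
  assumes p: "p \<in> topspace beta_omega" and q: "q \<in> topspace beta_omega"
    and eq: "ultrafilter_of p = ultrafilter_of q"
  shows "p = q"
proof (rule PiE_ext)
  show "p \<in> (\<Pi>\<^sub>E f\<in>unit_maps (discrete_topology UNIV). {0..1})"
    "q \<in> (\<Pi>\<^sub>E f\<in>unit_maps (discrete_topology UNIV). {0..1})"
    using p q by (auto simp: beta_omega_eq)
  fix f :: "nat \<Rightarrow> real" assume f: "f \<in> unit_maps (discrete_topology UNIV)"
  have "\<bar>q f - p f\<bar> \<le> e" if "0 < e" for e
    using close_in_ultrafilter_of[OF p f that] ultrafilter_of_close[OF q f] eq by simp
  then have "\<bar>q f - p f\<bar> \<le> 0"
    by (rule field_le_epsilon) simp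
  then show "p f = q f"
    by simp
qed

lemma topspace_omega_star: "topspace omega_star = topspace beta_omega - range omega_embed"
  by (auto simp: stone_cech_remainder_def)

lemma free_ultrafilter_of:
  assumes "p \<in> topspace omega_star"
  shows "free_ultrafilter (ultrafilter_of p)"
proof -
  have p: "p \<in> topspace beta_omega" and notin: "p \<notin> range omega_embed"
    using assms by (auto simp: topspace_omega_star)
  have up: "C \<in> ultrafilter_of p" if "B \<in> ultrafilter_of p" "B \<subseteq> C" for B C
    using ultrafilter_of_Int[OF p, of B C] that by (simp add: Int_absorb2)
  have sing: "{n} \<notin> ultrafilter_of p" for n
  proof
    assume n: "{n} \<in> ultrafilter_of p"
    have "p = omega_embed n"
    proof (rule PiE_ext)
      show "p \<in> (\<Pi>\<^sub>E f\<in>unit_maps (discrete_topology UNIV). {0..1})"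
        using p by (auto simp: beta_omega_eq)
      show "omega_embed n \<in> (\<Pi>\<^sub>E f\<in>unit_maps (discrete_topology UNIV). {0..1})"
        using range_omega_embed_subset by auto
      fix f :: "nat \<Rightarrow> real" assume f: "f \<in> unit_maps (discrete_topology UNIV)"
      have "\<bar>p f - f n\<bar> \<le> e" if "0 < e" for e
        using that by (intro ultrafilter_of_close[OF p f] up[OF n]) auto
      then have "\<bar>p f - f n\<bar> \<le> 0"
        by (rule field_le_epsilon) simp
      then show "p f = omega_embed n f"
        using omega_embed_apply[OF f] by simp
    qed
    with notin show False by blast
  qed
  have "infinite B" if "B \<in> ultrafilter_of p" for B
  proof
    assume "finite B"
    then show False
      using that
    proof (induction B)
      case empty
      then show ?case using up[of "{}" "{0}"] sing by blast
    next
      case (insert n B)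
      then have "- B \<in> ultrafilter_of p"
        using ultrafilter_of_Compl[OF p] by blast
      then have "insert n B \<inter> - B \<in> ultrafilter_of p"
        using ultrafilter_of_Int[OF p] insert.prems by blast
      then show ?case
        using up[of "insert n B \<inter> - B" "{n}"] sing by blast
    qed
  qed
  then show ?thesis
    unfolding free_ultrafilter_def
    using up ultrafilter_of_Int[OF p] ultrafilter_of_Compl[OF p] by (intro conjI ballI allI impI) blast+
qed

lemma openin_omega_star_ultrafilter:
  "openin omega_star {p \<in> topspace omega_star. B \<in> ultrafilter_of p}"
proof -
  have "openin beta_omega {p \<in> topspace beta_omega. p (indicator B) \<in> {1/2<..}}"
    by (rule openin_continuous_map_preimage[OF continuous_map_beta_omega_coord])
       (auto simp: indicator_in_unit_maps)
  moreover have "{p \<in> topspace beta_omega. p (indicator B) \<in> {1/2<..}} =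
      {p \<in> topspace beta_omega. B \<in> ultrafilter_of p}"
    by (auto simp: beta_omega_indicator split: if_splits)
  ultimately have "openin beta_omega {p \<in> topspace beta_omega. B \<in> ultrafilter_of p}"
    by simp
  then show ?thesis
    unfolding stone_cech_remainder_def openin_subtopology
    by (intro exI[of _ "{p \<in> topspace beta_omega. B \<in> ultrafilter_of p}"]) auto
qed

text \<open>The closures of subsets of the natural numbers form a base of the remainder.\<close>
lemma omega_star_base:
  assumes W: "openin omega_star W" and pW: "p \<in> W"
  shows "\<exists>B\<in>ultrafilter_of p. \<forall>q\<in>topspace omega_star. B \<in> ultrafilter_of q \<longrightarrow> q \<in> W"
proof -
  have p: "p \<in> topspace omega_star"
    using assms openin_subset by blast
  then have p\<beta>: "p \<in> topspace beta_omega"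
    by (simp add: topspace_omega_star)
  obtain W' where W': "openin beta_omega W'" "W = W' \<inter> (topspace beta_omega - range omega_embed)"
    using W by (auto simp: stone_cech_remainder_def openin_subtopology)
  obtain O' where O': "openin omega_cube O'" "W' = O' \<inter> topspace beta_omega"
    using W'(1) unfolding topspace_beta_omega unfolding beta_omega_eq openin_subtopology by blast
  have "p \<in> O'"
    using pW W' O' by blast
  from O'(1)[unfolded openin_product_topology_alt, THEN bspec, OF this]
  obtain U where U: "finite {f \<in> unit_maps (discrete_topology UNIV). U f \<noteq> topspace (top_of_set {0..1::real})}"
      "\<forall>f\<in>unit_maps (discrete_topology UNIV). openin (top_of_set {0..1}) (U f)"
      "p \<in> PiE (unit_maps (discrete_topology UNIV)) U" "PiE (unit_maps (discrete_topology UNIV)) U \<subseteq> O'"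
    by (elim exE conjE) (rule that)
  define F where "F = {f \<in> unit_maps (discrete_topology (UNIV :: nat set)). U f \<noteq> {0..1}}"
  have finF: "finite F"
    using U(1) by (simp add: F_def)
  have "\<exists>e>0. \<forall>t\<in>{0..1}. \<bar>t - p f\<bar> \<le> e \<longrightarrow> t \<in> U f"
    if f: "f \<in> unit_maps (discrete_topology UNIV)" for f
  proof -
    have "p f \<in> U f"
      using U(3) f by (auto simp: PiE_iff)
    then obtain e where "e > 0" "ball (p f) e \<inter> {0..1} \<subseteq> U f"
      using bspec[OF U(2) f] unfolding openin_contains_ball by blast
    moreover from this have "t \<in> ball (p f) e" if "\<bar>t - p f\<bar> \<le> e/2" for t
      using that unfolding mem_ball dist_real_def by linarith
    ultimately show ?thesis
      by (intro exI[of _ "e/2"]) auto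
  qed
  then obtain e where e: "\<And>f. f \<in> unit_maps (discrete_topology UNIV) \<Longrightarrow> e f > 0"
    "\<And>f t. f \<in> unit_maps (discrete_topology UNIV) \<Longrightarrow> t \<in> {0..1} \<Longrightarrow> \<bar>t - p f\<bar> \<le> e f \<Longrightarrow> t \<in> U f"
    by metis
  define C where "C f = {n. \<bar>f n - p f\<bar> < e f}" for f
  show ?thesis
  proof (intro bexI ballI impI)
    show "(\<Inter>f\<in>F. C f) \<in> ultrafilter_of p"
      using finF close_in_ultrafilter_of[OF p\<beta>] e(1)
      by (intro free_ultrafilter_INT[OF free_ultrafilter_of[OF p]]) (auto simp: C_def F_def)
    fix q assume q: "q \<in> topspace omega_star" and C: "(\<Inter>f\<in>F. C f) \<in> ultrafilter_of q"
    have q\<beta>: "q \<in> topspace beta_omega"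
      using q by (simp add: topspace_omega_star)
    have "q f \<in> U f" if f: "f \<in> unit_maps (discrete_topology UNIV)" for f
    proof (cases "f \<in> F")
      case True
      then have "C f \<in> ultrafilter_of q"
        by (intro free_ultrafilter_mono[OF free_ultrafilter_of[OF q] C]) blast
      then have "\<bar>q f - p f\<bar> \<le> e f"
        unfolding C_def by (rule ultrafilter_of_close[OF q\<beta> f])
      then show ?thesis
        using beta_omega_coord_bounds[OF f q\<beta>] by (intro e(2)[OF f]) auto
    next
      case False
      then show ?thesis
        using f beta_omega_coord_bounds[OF f q\<beta>] by (auto simp: F_def)
    qed
    moreover have "q \<in> extensional (unit_maps (discrete_topology UNIV))"
      using q\<beta> by (auto simp: beta_omega_eq PiE_iff)
    ultimately have "q \<in> O'"
      using U(4) by (auto simp: PiE_def)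
    then show "q \<in> W"
      using W'(2) O'(2) q q\<beta> by (simp add: topspace_omega_star)
  qed
qed

text \<open>By compactness every free ultrafilter arises from a point of the remainder.\<close>
lemma exists_omega_star_point:
  assumes u: "free_ultrafilter u"
  obtains p where "p \<in> topspace omega_star" "ultrafilter_of p = u"
proof -
  define K where "K B = {p \<in> topspace beta_omega. p (indicator B) \<in> {1}}" for B
  have "closedin beta_omega (K B)" for B
    unfolding K_def
    by (rule closedin_continuous_map_preimage[OF continuous_map_beta_omega_coord])
       (auto simp: indicator_in_unit_maps)
  moreover have "\<Inter>\<F> \<noteq> {}" if F: "finite \<F>" "\<F> \<subseteq> K ` u" for \<F>
  proof -
    obtain T where T: "finite T" "T \<subseteq> u" "\<F> = K ` T"
      using finite_subset_image[OF F] by metis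
    have "(\<Inter>B\<in>T. B) \<in> u"
      by (rule free_ultrafilter_INT[OF u]) (use T in auto)
    then have "infinite (\<Inter>B\<in>T. B)"
      by (rule free_ultrafilter_infinite[OF u])
    then obtain n where n: "\<And>B. B \<in> T \<Longrightarrow> n \<in> B"
      by (metis INT_iff ex_in_conv finite.emptyI)
    have "omega_embed n \<in> topspace beta_omega"
      unfolding topspace_beta_omega using closure_of_subset[OF range_omega_embed_subset] by blast
    then have "omega_embed n \<in> \<Inter>\<F>"
      using n by (auto simp: T(3) K_def omega_embed_apply indicator_in_unit_maps)
    then show ?thesis by blast
  qed
  ultimately have "\<Inter>(K ` u) \<noteq> {}"
    using compact_space_beta_omega[unfolded compact_space_fip, rule_format, of "K ` u"] by blast
  then obtain p where "p \<in> \<Inter>(K ` u)"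
    by blast
  then have pK: "p \<in> K B" if "B \<in> u" for B
    using that by blast
  have "UNIV \<in> u"
    using free_ultrafilter_INT[OF u, of "{}"] by simp
  then have p: "p \<in> topspace beta_omega"
    using pK by (auto simp: K_def)
  have sub: "B \<in> ultrafilter_of p" if "B \<in> u" for B
    using pK[OF that] by (simp add: K_def ultrafilter_of_def)
  have "B \<in> u" if "B \<in> ultrafilter_of p" for B
    using sub[of "- B"] that free_ultrafilter_Compl[OF u] ultrafilter_of_Compl[OF p] by blast
  then have eq: "ultrafilter_of p = u"
    using sub by blast
  have "p \<notin> range omega_embed"
  proof
    assume "p \<in> range omega_embed"
    then obtain n where "p = omega_embed n" by blast
    then have "{n} \<in> ultrafilter_of p"
      by (simp add: ultrafilter_of_def omega_embed_apply indicator_in_unit_maps)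
    then show False
      using free_ultrafilter_infinite[OF u] eq by blast
  qed
  then show ?thesis
    using that p eq by (simp add: topspace_omega_star)
qed

lemma weak_P_point_omega_star:
  assumes p: "p \<in> topspace omega_star" and wP: "weak_P_ultrafilter (ultrafilter_of p)"
  shows "weak_P_point omega_star p"
  unfolding weak_P_point_def
proof (intro conjI allI impI p, elim conjE)
  fix B assume B: "countable B" "B \<subseteq> topspace omega_star - {p}"
  have "ultrafilter_of p \<notin> ultrafilter_of ` B"
    using ultrafilter_of_inj p B(2) unfolding topspace_omega_star by blast
  moreover have "\<forall>c\<in>ultrafilter_of ` B. free_ultrafilter c"
    using B(2) free_ultrafilter_of by blast
  ultimately have "\<exists>D\<in>ultrafilter_of p. \<forall>c\<in>ultrafilter_of ` B. D \<notin> c"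
    using wP countable_image[OF B(1)] unfolding weak_P_ultrafilter_def by metis
  then obtain D where D: "D \<in> ultrafilter_of p" "\<And>q. q \<in> B \<Longrightarrow> D \<notin> ultrafilter_of q"
    by blast
  define S where "S = {q \<in> topspace omega_star. D \<in> ultrafilter_of q}"
  have "openin omega_star S" "p \<in> S" "\<And>q. q \<in> B \<Longrightarrow> q \<notin> S"
    using openin_omega_star_ultrafilter[of D] D p by (auto simp: S_def)
  then show "p \<notin> omega_star closure_of B"
    unfolding in_closure_of by metis
qed

section \<open>The space of weak P-points\<close>

lemma topspace_weak_P_points_omega_star:
  "topspace weak_P_points_omega_star = {p. weak_P_point omega_star p}"
  by (auto simp: weak_P_points_omega_star_def weak_P_point_def)

lemma weak_P_points_omega_star_base:
  assumes W: "openin weak_P_points_omega_star W" and pW: "p \<in> W"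
  shows "\<exists>B\<in>ultrafilter_of p.
           \<forall>q\<in>topspace weak_P_points_omega_star. B \<in> ultrafilter_of q \<longrightarrow> q \<in> W"
proof -
  obtain W' where W': "openin omega_star W'" "W = W' \<inter> {p. weak_P_point omega_star p}"
    using W by (auto simp: weak_P_points_omega_star_def openin_subtopology)
  have "p \<in> W'"
    using pW W'(2) by blast
  then obtain B where B: "B \<in> ultrafilter_of p"
    "\<forall>q\<in>topspace omega_star. B \<in> ultrafilter_of q \<longrightarrow> q \<in> W'"
    using omega_star_base[OF W'(1)] by blast
  have "q \<in> W" if "q \<in> topspace weak_P_points_omega_star" "B \<in> ultrafilter_of q" for q
    using that B(2) W'(2) by (simp add: topspace_weak_P_points_omega_star weak_P_point_def)
  with B(1) show ?thesis
    by blast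
qed

text \<open>Every sequence of disjoint infinite sets has a weak P-point at which it accumulates.\<close>
lemma exists_weak_P_point:
  fixes A :: "nat \<Rightarrow> nat set"
  assumes "\<And>j. infinite (A j)" "disjoint_family A"
  obtains p where "p \<in> topspace weak_P_points_omega_star" "columnwise_cofinite A \<subseteq> ultrafilter_of p"
proof -
  obtain u where u: "weak_P_ultrafilter u" "columnwise_cofinite A \<subseteq> u"
    using exists_weak_P_ultrafilter[OF assms] .
  then have "free_ultrafilter u"
    by (simp add: weak_P_ultrafilter_def)
  then obtain p where "p \<in> topspace omega_star" "ultrafilter_of p = u"
    using exists_omega_star_point by blast
  then show ?thesis
    using weak_P_point_omega_star[of p] u
    by (intro that[of p]) (simp_all add: topspace_weak_P_points_omega_star)
qed

lemma infinite_nat_set_partition: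
  fixes C :: "nat set"
  assumes "infinite C"
  obtains A :: "nat \<Rightarrow> nat set"
  where "\<And>j. infinite (A j)" "disjoint_family A" "\<And>j. A j \<subseteq> C"
proof
  let ?A = "\<lambda>j. enumerate C ` range (\<lambda>m. prod_encode (j, m))"
  have inj: "inj (enumerate C)"
    using assms by (simp add: strict_mono_enumerate strict_mono_imp_inj_on)
  have "inj (\<lambda>m. prod_encode (j, m))" for j
    by (auto intro!: injI)
  then show "infinite (?A j)" for j
    using inj by (metis finite_imageD inj_on_subset infinite_UNIV_nat subset_UNIV)
  show "disjoint_family ?A"
    by (auto simp: disjoint_family_on_def inj_eq[OF inj])
  show "?A j \<subseteq> C" for j
    using enumerate_in_set[OF assms] by auto
qed

lemma weak_P_points_omega_star_dense:
  assumes "infinite C"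
  obtains p where "p \<in> topspace weak_P_points_omega_star" "C \<in> ultrafilter_of p"
proof -
  obtain A :: "nat \<Rightarrow> nat set" where A: "\<And>j. infinite (A j)" "disjoint_family A" "\<And>j. A j \<subseteq> C"
    using infinite_nat_set_partition[OF assms] by metis
  then have "finite (A j - C)" for j
    by (metis Diff_eq_empty_iff finite.emptyI)
  then have "C \<in> columnwise_cofinite A"
    by (simp add: columnwise_cofinite_def)
  then show ?thesis
    using exists_weak_P_point[OF A(1,2)] that by blast
qed

text \<open>Countable sets of weak P-points are discrete. Take an infinite one, \<open>d j\<close>, together with a
  discrete family of open sets around its points. Each of these contains all weak P-points in the closure
  of some set \<open>B j\<close>, and by density the \<open>B j\<close> are almost disjoint. After making them disjoint, a weak
  P-point at which they accumulate contradicts discreteness of the family.\<close>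
lemma not_homeomorphic_weak_P_points_omega_star:
  assumes X: "\<And>A. A \<subseteq> topspace X \<Longrightarrow> countable A \<Longrightarrow> has_extender X A"
  shows "\<not> X homeomorphic_space weak_P_points_omega_star"
proof
  let ?W = weak_P_points_omega_star
  assume "X homeomorphic_space ?W"
  then obtain h g where h: "continuous_map X ?W h" and g: "continuous_map ?W X g"
    and gh: "\<And>x. x \<in> topspace X \<Longrightarrow> g (h x) = x" and hg: "\<And>w. w \<in> topspace ?W \<Longrightarrow> h (g w) = w"
    unfolding homeomorphic_space_def homeomorphic_maps_def by metis
  have gX: "g w \<in> topspace X" if "w \<in> topspace ?W" for w
    using continuous_map_image_subset_topspace[OF g] that by blast
  have free: "free_ultrafilter (ultrafilter_of w)" if "w \<in> topspace ?W" for w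
    using that free_ultrafilter_of by (simp add: topspace_weak_P_points_omega_star weak_P_point_def)

  obtain P :: "nat \<Rightarrow> nat set" where P: "\<And>j. infinite (P j)" "disjoint_family P"
    using infinite_nat_set_partition[OF infinite_UNIV_nat] by metis
  have "\<exists>w. w \<in> topspace ?W \<and> P j \<in> ultrafilter_of w" for j
    using weak_P_points_omega_star_dense[OF P(1)] by metis
  then obtain d where d: "\<And>j. d j \<in> topspace ?W" "\<And>j. P j \<in> ultrafilter_of (d j)"
    by metis
  have d_inj: "i = j" if "d i = d j" for i j
  proof (rule ccontr)
    assume "i \<noteq> j"
    then have "P i \<inter> P j = {}"
      using P(2) by (simp add: disjoint_family_on_def)
    moreover have "P i \<inter> P j \<in> ultrafilter_of (d i)"
      using d(2)[of i] d(2)[of j] that by (intro free_ultrafilter_Int[OF free[OF d(1)]]) auto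
    ultimately show False
      using free_ultrafilter_infinite[OF free[OF d(1)]] by fastforce
  qed

  define A where "A = range (\<lambda>j. g (d j))"
  have AX: "A \<subseteq> topspace X"
    using gX d(1) by (auto simp: A_def)
  have cA: "countable A"
    by (simp add: A_def)
  have "subtopology X A = discrete_topology A"
    unfolding subtopology_eq_discrete_iff[OF AX]
  proof
    fix a assume "a \<in> A"
    then obtain j where a: "a = g (d j)"
      by (auto simp: A_def)
    have "weak_P_point omega_star (d j)" "range d - {d j} \<subseteq> topspace omega_star - {d j}"
      using d(1) by (auto simp: topspace_weak_P_points_omega_star weak_P_point_def)
    then have "d j \<in> topspace omega_star" "d j \<notin> omega_star closure_of (range d - {d j})"
      unfolding weak_P_point_def by auto
    then obtain U where U: "openin omega_star U" "d j \<in> U" "U \<inter> (range d - {d j}) = {}"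
      unfolding in_closure_of by blast
    have "openin ?W (U \<inter> topspace ?W)"
      unfolding weak_P_points_omega_star_def topspace_subtopology
      using U(1) openin_subset[OF U(1)] openin_subtopology by (metis inf.absorb1 inf.assoc)
    then have "openin X {x \<in> topspace X. h x \<in> U \<inter> topspace ?W}"
      by (rule openin_continuous_map_preimage[OF h])
    moreover have "{x \<in> topspace X. h x \<in> U \<inter> topspace ?W} \<inter> A = {a}"
      using U(2,3) hg gX d(1) by (auto simp: A_def a)
    ultimately show "\<exists>U. openin X U \<and> U \<inter> A = {a}"
      by blast
  qed
  then have "strongly_functionally_discrete X A"
    by (intro strongly_functionally_discrete_if_discrete X AX cA)
  then obtain G where G: "discrete_family X A G" "\<And>a. a \<in> A \<Longrightarrow> functionally_open X (G a)"
    "\<And>a. a \<in> A \<Longrightarrow> a \<in> G a"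
    by (auto simp: strongly_functionally_discrete_def)
  have open_G: "openin X (G a)" if a: "a \<in> A" for a
  proof -
    obtain f where f: "continuous_map X euclideanreal f" "G a = {x \<in> topspace X. f x \<noteq> 0}"
      using G(2)[OF a] unfolding functionally_open_def by blast
    have "openin X {x \<in> topspace X. f x \<in> - {0}}"
      by (rule openin_continuous_map_preimage[OF f(1)]) auto
    then show ?thesis
      using f(2) by simp
  qed

  have "\<exists>B\<in>ultrafilter_of (d j). \<forall>w\<in>topspace ?W. B \<in> ultrafilter_of w \<longrightarrow> g w \<in> G (g (d j))" for j
  proof -
    have dA: "g (d j) \<in> A"
      by (simp add: A_def)
    have op: "openin ?W {w \<in> topspace ?W. g w \<in> G (g (d j))}"
      by (rule openin_continuous_map_preimage[OF g open_G[OF dA]])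
    have "d j \<in> {w \<in> topspace ?W. g w \<in> G (g (d j))}"
      using d(1) G(3)[OF dA] by blast
    from weak_P_points_omega_star_base[OF op this] show ?thesis
      by simp
  qed
  then obtain B where B: "\<And>j. B j \<in> ultrafilter_of (d j)"
    "\<And>j w. w \<in> topspace ?W \<Longrightarrow> B j \<in> ultrafilter_of w \<Longrightarrow> g w \<in> G (g (d j))"
    by metis
  have inf_B: "infinite (B j)" for j
    using free_ultrafilter_infinite[OF free[OF d(1)] B(1)] .
  have gd_inj: "i = j" if "g (d i) = g (d j)" for i j
    using that hg d(1) d_inj by metis
  have B_ad: "finite (B i \<inter> B j)" if "i \<noteq> j" for i j
  proof (rule ccontr)
    assume "infinite (B i \<inter> B j)"
    then obtain w where w: "w \<in> topspace ?W" "B i \<inter> B j \<in> ultrafilter_of w"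
      by (rule weak_P_points_omega_star_dense)
    then have "B i \<in> ultrafilter_of w" "B j \<in> ultrafilter_of w"
      using free_ultrafilter_mono[OF free[OF w(1)] w(2)] by auto
    then have "g w \<in> G (g (d i)) \<inter> G (g (d j))"
      using B(2)[OF w(1)] by blast
    then show False
      using discrete_family_disjoint[OF G(1), of "g (d i)" "g (d j)"] gd_inj that by (auto simp: A_def)
  qed

  \<comment> \<open>Almost disjointness means that only finitely many elements of \<open>B j\<close> are removed.\<close>
  define D where "D j = B j - (\<Union>i<j. B i)" for j
  have "infinite (D j)" for j
  proof -
    have "finite (\<Union>i<j. B j \<inter> B i)"
      by (intro finite_UN_I B_ad) auto
    then have "infinite (B j - (\<Union>i<j. B j \<inter> B i))"
      using inf_B by (rule Diff_infinite_finite)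
    moreover have "B j - (\<Union>i<j. B j \<inter> B i) = D j"
      by (auto simp: D_def)
    ultimately show ?thesis by simp
  qed
  moreover have "D i \<inter> D j = {}" if "i < j" for i j
    using that by (auto simp: D_def)
  then have "disjoint_family D"
    unfolding disjoint_family_on_def by (metis Int_commute linorder_neqE_nat)
  ultimately obtain p where p: "p \<in> topspace ?W" "columnwise_cofinite D \<subseteq> ultrafilter_of p"
    by (rule exists_weak_P_point)
  obtain V where V: "openin X V" "g p \<in> V"
    "\<And>a b. a \<in> A \<Longrightarrow> b \<in> A \<Longrightarrow> G a \<inter> V \<noteq> {} \<Longrightarrow> G b \<inter> V \<noteq> {} \<Longrightarrow> a = b"
    using discrete_family_nhd[OF G(1) gX[OF p(1)]] by metis
  have op: "openin ?W {w \<in> topspace ?W. g w \<in> V}"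
    by (rule openin_continuous_map_preimage[OF g V(1)])
  have "p \<in> {w \<in> topspace ?W. g w \<in> V}"
    using p(1) V(2) by blast
  from weak_P_points_omega_star_base[OF op this]
  obtain C where C: "C \<in> ultrafilter_of p"
    "\<And>w. w \<in> topspace ?W \<Longrightarrow> C \<in> ultrafilter_of w \<Longrightarrow> g w \<in> V"
    by auto
  have meets: "G (g (d j)) \<inter> V \<noteq> {}" if inf_DC: "infinite (D j \<inter> C)" for j
  proof -
    obtain w where w: "w \<in> topspace ?W" "D j \<inter> C \<in> ultrafilter_of w"
      using inf_DC by (rule weak_P_points_omega_star_dense)
    then have "B j \<in> ultrafilter_of w" "C \<in> ultrafilter_of w"
      using free_ultrafilter_mono[OF free[OF w(1)] w(2)] by (auto simp: D_def)
    then show ?thesis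
      using B(2)[OF w(1)] C(2)[OF w(1)] by blast
  qed
  have unique: "i = j" if "infinite (D i \<inter> C)" "infinite (D j \<inter> C)" for i j
    using V(3)[OF _ _ meets[OF that(1)] meets[OF that(2)]] gd_inj by (auto simp: A_def)
  \<comment> \<open>At most one \<open>D j\<close> meets \<open>C\<close> in an infinite set, so the complement of \<open>C\<close> is a member of the filter.\<close>
  have "\<exists>n. \<forall>j\<ge>n. finite (D j \<inter> C)"
  proof (cases "\<exists>i. infinite (D i \<inter> C)")
    case True
    then obtain i where "infinite (D i \<inter> C)"
      by blast
    then have "finite (D j \<inter> C)" if "j \<ge> Suc i" for j
      using unique[of i j] that by force
    then show ?thesis by blast
  qed simp
  then have "- C \<in> columnwise_cofinite D"
    by (simp add: columnwise_cofinite_def eventually_sequentially Diff_eq)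
  then show False
    using p(2) C(1) free_ultrafilter_Compl[OF free[OF p(1)]] by blast
qed

section \<open>Consequences of the extension property for countable sets\<close>

theorem corollary2p4:
  fixes X :: "'a topology"
  assumes "\<And>A. A \<subseteq> topspace X \<Longrightarrow> countable A \<Longrightarrow>
             \<exists>\<phi>. continuous_map (Cp_star (subtopology X A)) (Cp X) \<phi> \<and>
                 (\<forall>y\<in>topspace (Cp_star (subtopology X A)). restrict (\<phi> y) A = y)"
  shows "(\<forall>A. A \<subseteq> topspace X \<and> countable A \<and> subtopology X A = discrete_topology A
              \<longrightarrow> strongly_functionally_discrete X A)
       \<and> (Hausdorff_space X \<and>
              (\<forall>\<U>. (\<forall>U\<in>\<U>. functionally_open X U) \<and> locally_finite_in X \<U> \<longrightarrow> finite \<U>)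
            \<longrightarrow> finite (topspace X))
       \<and> (Hausdorff_space X \<and> pseudocompact_space X \<longrightarrow> finite (topspace X))
       \<and> \<not> X homeomorphic_space weak_P_points_omega_star
       \<and> (completely_regular_space X \<and> Hausdorff_space X \<longrightarrow>
            (\<forall>A. A \<subseteq> topspace X \<and> countable A \<longrightarrow> strongly_functionally_discrete X A))"
proof -
  have X: "has_extender X A" if "A \<subseteq> topspace X" "countable A" for A
    using assms[OF that] by (simp add: has_extender_def)
  have discrete: "strongly_functionally_discrete X A"
    if "A \<subseteq> topspace X" "countable A" "subtopology X A = discrete_topology A" for A
    using strongly_functionally_discrete_if_discrete X that by blast
  have "finite (topspace X)"
    if "Hausdorff_space X"
      and "\<forall>\<U>. (\<forall>U\<in>\<U>. functionally_open X U) \<and> locally_finite_in X \<U> \<longrightarrow> finite \<U>"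
    using finite_if_locally_finite_functionally_open[OF X that(1)] that(2) by simp
  moreover have "finite (topspace X)" if "Hausdorff_space X" "pseudocompact_space X"
    using finite_if_pseudocompact[OF X that] by simp
  moreover have "\<not> X homeomorphic_space weak_P_points_omega_star"
    using not_homeomorphic_weak_P_points_omega_star[OF X] by simp
  moreover have "strongly_functionally_discrete X A"
    if reg: "completely_regular_space X" "Hausdorff_space X" and A: "A \<subseteq> topspace X" "countable A" for A
  proof (rule discrete[OF A])
    have "has_extender X B" if "B \<subseteq> A" for B
      using X A that by (meson countable_subset subset_trans)
    then show "subtopology X A = discrete_topology A"
      using extender_completely_regular_imp_discrete A reg by blast
  qed
  ultimately show ?thesis
    using discrete by simp
qed

end
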